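(* Let $M\ge2$, $\mathbb E=\{1,\ldots,M\}$ and $p_k\in[0,1]$, $k=1,\ldots,M-1$. Let $(a_k)_{k=1}^M$ and $(\pi(k))_{k=1}^M$ be two probability distributions on $\mathbb E$ such that $a_k\ge0$ and $\pi(k)>0$ for all $k\in\mathbb E$, and put $H(k)=\sum_{j=1}^k\pi(j)$. Define the matrix $$\mathbf P(k,s)=\begin{cases} 1-\frac{\pi(2)}{\pi(1)+\pi(2)}p_1 & k=s=1,\\[1mm] \frac{\pi(2)}{\pi(1)+\pi(2)}p_1 & k=1,\ s=2,\\[1mm] \frac{\pi(s)}{\pi(k)}\left[p_{k-1}\left(1-\frac{H(k-1)}{H(k)}\right)-p_k\left(1-\frac{H(k)}{H(k+1)}\right)\right] & 1<k<M,\ s<k,\\[1mm] 1-p_k\left(1-\frac{H(k)}{H(k+1)}\right)-p_{k-1}\frac{H(k-1)}{H(k)} & 1<k<M,\ s=k,\\[1mm] p_k\frac{H(k)}{H(k+1)}\frac{\pi(k+1)}{\pi(k)} & 1<k<M,\ s=k+1,\\[1mm] p_{M-1}\pi(s) & k=M,\ s\le M-1,\\[1mm] 1-p_{M-1}+p_{M-1}\pi(M) & k=M,\ s=M, \end{cases}$$ all other entries being $0$. Assume that $\pi$ and the sequence $\{p_k\}$ are such that the matrix $\mathbf P$ is non-negative. Then the Markov chain $X$ with transition matrix $\mathbf P$ and with initial distribution $\nu=(\nu(1),\ldots,\nu(M))$ given by $$\nu(k)=\pi(k)\sum_{i=k}^M\frac{a_i}{H(i)}$$ has the fastest strong stationary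 time $T$ distributed as the mixture $$\sum_{i=1}^{M-1}a_i\,\mathcal G(p_i,p_{i+1},\ldots,p_{M-1})$$ (with the remaining mass $a_M$ placed at $0$), and $\pi$ is its stationary distribution. Moreover, $\{1-p_1,\ldots,1-p_{M-1},1\}$ are the eigenvalues of $\mathbf P$.
   Context: $\mathcal G(q_1,\ldots,q_n)$ denotes the distribution of $\sum_{j=1}^n X_j$ with $X_j\sim Geo(q_j)$ independent, where $Geo(q)$ is the geometric distribution on $\{1,2,\ldots\}$: $P(X=n)=q(1-q)^{n-1}$; by convention $Geo(0)$ is the point mass at $+\infty$. A weighted sum $\sum a_i\mu_i$ of distributions is a mixture. Separation: $sep(\nu\mathbf P^k,\pi)=\max_{e}\left(1-\nu\mathbf P^k(e)/\pi(e)\right)$. A strong stationary time for $X$ is a random time $T$ such that $X_T$ has distribution $\pi$ and $T$ is independent of $X_T$; the fastest strong stationary time (FSST) is the stochastically smallest one, and its law is determined by $P(T>k)=sep(\nu\mathbf P^k,\pi)$ for all $k\ge0$. *)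

theory Defs
  imports "HOL-Probability.Probability" "Jordan_Normal_Form.Spectral_Radius"
begin

text \<open>Distributions, functions and matrices on the state space \<open>{1..M}\<close> are represented by
  functions on \<^typ>\<open>nat\<close>; only their values on \<open>{1..M}\<close> matter.\<close>

definition prob_vector :: "nat \<Rightarrow> (nat \<Rightarrow> real) \<Rightarrow> bool" where
  "prob_vector M f \<longleftrightarrow> (\<forall>k\<in>{1..M}. 0 \<le> f k) \<and> (\<Sum>k\<in>{1..M}. f k) = 1"

definition stochastic_matrix :: "nat \<Rightarrow> (nat \<Rightarrow> nat \<Rightarrow> real) \<Rightarrow> bool" where
  "stochastic_matrix M P \<longleftrightarrow> (\<forall>k\<in>{1..M}. prob_vector M (P k))"

definition stationary :: "nat \<Rightarrow> (nat \<Rightarrow> nat \<Rightarrow> real) \<Rightarrow> (nat \<Rightarrow> real) \<Rightarrow> bool" where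
  "stationary M P \<pi> \<longleftrightarrow>
     prob_vector M \<pi> \<and> (\<forall>s\<in>{1..M}. (\<Sum>k\<in>{1..M}. \<pi> k * P k s) = \<pi> s)"

fun dist_at :: "nat \<Rightarrow> (nat \<Rightarrow> real) \<Rightarrow> (nat \<Rightarrow> nat \<Rightarrow> real) \<Rightarrow> nat \<Rightarrow> nat \<Rightarrow> real" where
  "dist_at M \<nu> P 0 s = \<nu> s"
| "dist_at M \<nu> P (Suc n) s = (\<Sum>k\<in>{1..M}. dist_at M \<nu> P n k * P k s)"

definition sep :: "nat \<Rightarrow> (nat \<Rightarrow> real) \<Rightarrow> (nat \<Rightarrow> real) \<Rightarrow> real" where
  "sep M \<mu> \<pi> = (MAX e\<in>{1..M}. 1 - \<mu> e / \<pi> e)"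

definition to_mat :: "nat \<Rightarrow> (nat \<Rightarrow> nat \<Rightarrow> real) \<Rightarrow> real mat" where
  "to_mat M P = mat M M (\<lambda>(i, j). P (Suc i) (Suc j))"


definition markov_chain ::
  "nat \<Rightarrow> (nat \<Rightarrow> real) \<Rightarrow> (nat \<Rightarrow> nat \<Rightarrow> real) \<Rightarrow> 'w measure \<Rightarrow> (nat \<Rightarrow> 'w \<Rightarrow> nat) \<Rightarrow> bool" where
  "markov_chain M \<nu> P \<Omega> X \<longleftrightarrow>
     prob_space \<Omega> \<and>
     (\<forall>n. X n \<in> measurable \<Omega> (count_space {1..M})) \<and>
     (\<forall>k\<in>{1..M}. \<P>(\<omega> in \<Omega>. X 0 \<omega> = k) = \<nu> k) \<and>
     (\<forall>n x. \<forall>s\<in>{1..M}. \<P>(\<omega> in \<Omega>. \<forall>i\<le>n. X i \<omega> = x i) > 0 \<longrightarrow>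
        \<P>(\<omega> in \<Omega>. X (Suc n) \<omega> = s \<bar> \<forall>i\<le>n. X i \<omega> = x i) = P (x n) s)"

text \<open>Given the chain up to time \<open>k\<close>, the event \<open>T = k\<close> is conditionally independent of the
  future of the chain. External randomisation is allowed; the value \<open>\<infinity>\<close> is allowed.\<close>

definition randomized_stopping_time ::
  "'w measure \<Rightarrow> (nat \<Rightarrow> 'w \<Rightarrow> nat) \<Rightarrow> ('w \<Rightarrow> enat) \<Rightarrow> bool" where
  "randomized_stopping_time \<Omega> X T \<longleftrightarrow>
     T \<in> measurable \<Omega> (count_space UNIV) \<and>
     (\<forall>k n x. k \<le> n \<longrightarrow> \<P>(\<omega> in \<Omega>. \<forall>i\<le>n. X i \<omega> = x i) > 0 \<longrightarrow>
        \<P>(\<omega> in \<Omega>. T \<omega> = enat k \<bar> \<forall>i\<le>n. X i \<omega> = x i) =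
        \<P>(\<omega> in \<Omega>. T \<omega> = enat k \<bar> \<forall>i\<le>k. X i \<omega> = x i))"

text \<open>Since \<open>X\<^sub>T\<close> only exists on \<open>T < \<infinity>\<close>, the requirements that \<open>X\<^sub>T\<close> has distribution \<open>\<pi>\<close> and is
  independent of \<open>T\<close> refer to the conditional probability given \<open>T < \<infinity>\<close>.\<close>

definition strong_stationary_time ::
  "nat \<Rightarrow> (nat \<Rightarrow> real) \<Rightarrow> 'w measure \<Rightarrow> (nat \<Rightarrow> 'w \<Rightarrow> nat) \<Rightarrow> ('w \<Rightarrow> enat) \<Rightarrow> bool" where
  "strong_stationary_time M \<pi> \<Omega> X T \<longleftrightarrow>
     randomized_stopping_time \<Omega> X T \<and>
     (\<P>(\<omega> in \<Omega>. T \<omega> < \<infinity>) > 0 \<longrightarrow>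
       (let Q = uniform_measure \<Omega> {\<omega> \<in> space \<Omega>. T \<omega> < \<infinity>};
            XT = (\<lambda>\<omega>. X (the_enat (T \<omega>)) \<omega>)
        in (\<forall>e\<in>{1..M}. \<P>(\<omega> in Q. XT \<omega> = e) = \<pi> e) \<and>
           prob_space.indep_var Q (count_space UNIV) T (count_space UNIV) XT))"

text \<open>The competitors are the strong stationary times of all chains with initial distribution
  \<open>\<nu>\<close> and transition matrix \<open>P\<close>, on probability spaces over an arbitrary type \<open>'v\<close>; the first
  argument only serves to name that type.\<close>

definition fastest_strong_stationary_time ::
  "'v itself \<Rightarrow> nat \<Rightarrow> (nat \<Rightarrow> real) \<Rightarrow> (nat \<Rightarrow> nat \<Rightarrow> real) \<Rightarrow> (nat \<Rightarrow> real) \<Rightarrow>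
     'w measure \<Rightarrow> (nat \<Rightarrow> 'w \<Rightarrow> nat) \<Rightarrow> ('w \<Rightarrow> enat) \<Rightarrow> bool" where
  "fastest_strong_stationary_time (_ :: 'v itself) M \<nu> P \<pi> \<Omega> X T \<longleftrightarrow>
     markov_chain M \<nu> P \<Omega> X \<and> strong_stationary_time M \<pi> \<Omega> X T \<and>
     (\<forall>(\<Omega>' :: 'v measure) X' T'.
        markov_chain M \<nu> P \<Omega>' X' \<and> strong_stationary_time M \<pi> \<Omega>' X' T' \<longrightarrow>
        (\<forall>k. \<P>(\<omega> in \<Omega>. T \<omega> > enat k) \<le> \<P>(\<omega> in \<Omega>'. T' \<omega> > enat k)))"

text \<open>\<^const>\<open>geometric_pmf\<close> lives on \<open>{0, 1, \<dots>}\<close> and requires a positive parameter.\<close>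

definition geo_pmf :: "real \<Rightarrow> enat pmf" where
  "geo_pmf q = (if q = 0 then return_pmf \<infinity> else map_pmf (\<lambda>n. enat (Suc n)) (geometric_pmf q))"

text \<open>\<open>geo_sum_pmf q J\<close> is the distribution of the sum of independent \<open>X\<^sub>j \<sim> Geo(q\<^sub>j)\<close>, \<open>j \<in> J\<close>.
  The second argument of \<^const>\<open>Pi_pmf\<close> is a dummy value outside \<open>J\<close>.\<close>

definition geo_sum_pmf :: "(nat \<Rightarrow> real) \<Rightarrow> nat set \<Rightarrow> enat pmf" where
  "geo_sum_pmf q J = map_pmf (\<lambda>x. \<Sum>j\<in>J. x j) (Pi_pmf J 0 (\<lambda>j. geo_pmf (q j)))"


definition cumul :: "(nat \<Rightarrow> real) \<Rightarrow> nat \<Rightarrow> real" where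
  "cumul \<pi> k = (\<Sum>j=1..k. \<pi> j)"

definition trans_matrix ::
  "nat \<Rightarrow> (nat \<Rightarrow> real) \<Rightarrow> (nat \<Rightarrow> real) \<Rightarrow> nat \<Rightarrow> nat \<Rightarrow> real" where
  "trans_matrix M \<pi> p k s =
    (let H = cumul \<pi> in
     if k \<notin> {1..M} \<or> s \<notin> {1..M} then 0
     else if k = 1 then
       (if s = 1 then 1 - \<pi> 2 / (\<pi> 1 + \<pi> 2) * p 1
        else if s = 2 then \<pi> 2 / (\<pi> 1 + \<pi> 2) * p 1
        else 0)
     else if k < M then
       (if s < k then
          \<pi> s / \<pi> k * (p (k - 1) * (1 - H (k - 1) / H k) - p k * (1 - H k / H (k + 1)))
        else if s = k then 1 - p k * (1 - H k / H (k + 1)) - p (k - 1) * (H (k - 1) / H k)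
        else if s = k + 1 then p k * (H k / H (k + 1)) * (\<pi> (k + 1) / \<pi> k)
        else 0)
     else
       (if s \<le> M - 1 then p (M - 1) * \<pi> s
        else 1 - p (M - 1) + p (M - 1) * \<pi> M))"

definition init_dist :: "nat \<Rightarrow> (nat \<Rightarrow> real) \<Rightarrow> (nat \<Rightarrow> real) \<Rightarrow> nat \<Rightarrow> real" where
  "init_dist M \<pi> a k = \<pi> k * (\<Sum>i=k..M. a i / cumul \<pi> i)"

text \<open>A random time on an arbitrary probability space \<open>\<Omega>\<close> may need randomness that \<open>\<Omega>\<close> does not
  provide, so \<open>\<Omega>\<close> is extended by an independent uniform variable; \<open>X\<close> is carried over along the
  first projection.\<close>

definition enlarge :: "'w measure \<Rightarrow> ('w \<times> real) measure" where
  "enlarge \<Omega> = \<Omega> \<Otimes>\<^sub>M uniform_measure lborel {0..1}"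

definition lift_process :: "(nat \<Rightarrow> 'w \<Rightarrow> nat) \<Rightarrow> nat \<Rightarrow> 'w \<times> real \<Rightarrow> nat" where
  "lift_process X n = X n \<circ> fst"

end

theory Submission
  imports Defs
begin

text \<open>
  The chain is dual, in the sense of Diaconis and Fill, to the pure birth chain \<open>B\<close> on \<open>{1..M}\<close>
  that moves from \<open>i\<close> to \<open>i + 1\<close> with probability \<open>p i\<close> and is absorbed at \<open>M\<close>. The link between
  them sends \<open>i\<close> to \<open>\<pi>\<close> conditioned on \<open>{1..i}\<close>; write \<open>\<Lambda>\<close> for its matrix. The entries of \<open>P\<close>,
  odd as they look, are exactly the solution of \<open>\<Lambda> P = B \<Lambda>\<close>: row \<open>k\<close> of \<open>P\<close>, weighted by \<open>\<pi> k\<close>, is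
  the difference of two consecutive rows of \<open>B \<Lambda>\<close>, each weighted by \<open>H\<close>
  (\<open>trans_matrix_eq_flow_diff\<close>). Everything algebraic follows from this telescoping identity.

  \<^item> Summed over all \<open>k\<close> it gives stationarity of \<open>\<pi>\<close>, and summed over the columns it gives row sums 1.

  \<^item> \<open>\<Lambda>\<close> is triangular with nonzero diagonal, so \<open>P\<close> is similar to the triangular matrix \<open>B\<close>, whose
    diagonal is the list of eigenvalues (\<open>similar_birth_matrix\<close>).

  \<^item> The initial law is \<open>\<nu> = a \<Lambda>\<close>, hence the law of the chain at time \<open>n\<close> is the law of the dual at
    time \<open>n\<close> pushed through \<open>\<Lambda>\<close>. Only the dual state \<open>M\<close> charges the point \<open>M\<close>, and every other dual
    state can only increase the density with respect to \<open>\<pi>\<close> elsewhere. So the separation is attained at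
    \<open>M\<close> and equals the probability that the dual is not yet absorbed (\<open>sep_eq_dual\<close>).

  \<^item> Started at \<open>i\<close>, the dual spends independent geometric times in \<open>i, \<dots>, M - 1\<close>, so its absorption
    time has law \<open>\<G>(p i, \<dots>, p (M - 1))\<close> (\<open>dist_at_dual_top\<close>).

  That a fastest strong stationary time exists and has the separation as its tail is a fact about all
  finite chains with a positive stationary law (Aldous and Diaconis), proved here without the dual. No strong stationary time beats
  the separation, because on \<open>T \<le> k\<close> the state at time \<open>k\<close> has law \<open>\<pi>\<close> independently of \<open>T\<close>
  (\<open>sep_le_strong_stationary_time_tail\<close>). Conversely the chain is stopped with hazards,
  depending on the time and the current state only, for which the mass stopped at each time is the
  largest multiple of \<open>\<pi>\<close> below the law of the chain still running; a single uniform variable drives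
  all these decisions (\<open>ex_fastest_strong_stationary_time\<close>).
\<close>

text \<open>Keeping \<open>1\<close> intact lets facts about the state space \<open>{1..M}\<close> rewrite each other.\<close>

declare One_nat_def [simp del]

section \<open>Intertwining with a pure birth chain\<close>

definition birth_matrix :: "nat \<Rightarrow> (nat \<Rightarrow> real) \<Rightarrow> nat \<Rightarrow> nat \<Rightarrow> real" where
  "birth_matrix M p i j =
     (if j = i then (if i < M then 1 - p i else 1)
      else if j = Suc i \<and> i < M then p i else 0)"

text \<open>Row \<open>i\<close> is \<open>\<pi>\<close> conditioned on \<open>{1..i}\<close>.\<close>

definition truncation_link :: "(nat \<Rightarrow> real) \<Rightarrow> nat \<Rightarrow> nat \<Rightarrow> real" where
  "truncation_link \<pi> i s = (if s \<le> i then \<pi> s / cumul \<pi> i else 0)"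

lemma cumul_0 [simp]: "cumul \<pi> 0 = 0"
  and cumul_Suc: "cumul \<pi> (Suc k) = cumul \<pi> k + \<pi> (Suc k)"
  by (simp_all add: cumul_def)

text \<open>Averaging \<open>f\<close> against the two-point law of a birth step; this is the form in which the birth
  matrix enters every sum below.\<close>

lemma sum_birth_matrix:
  assumes "i \<in> {1..M}"
  shows "(\<Sum>j=1..M. birth_matrix M p i j * f j) =
    (if i < M then (1 - p i) * f i + p i * f (Suc i) else f i)"
proof -
  have "(\<Sum>j=1..M. birth_matrix M p i j * f j) =
    (\<Sum>j=1..M. (if j = i then (if i < M then 1 - p i else 1) * f i else 0)
              + (if j = Suc i then (if i < M then p i * f (Suc i) else 0) else 0))"
    by (intro sum.cong) (auto simp: birth_matrix_def)
  also have "\<dots> = (if i < M then (1 - p i) * f i + p i * f (Suc i) else f i)"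
    using assms by (simp add: sum.distrib)
  finally show ?thesis .
qed

context
  fixes M :: nat and p a \<pi> :: "nat \<Rightarrow> real"
  assumes M: "M \<ge> 2"
    and pi: "prob_vector M \<pi>" and pi_pos: "\<And>k. k \<in> {1..M} \<Longrightarrow> \<pi> k > 0"
begin

lemma cumul_pos: "i \<in> {1..M} \<Longrightarrow> cumul \<pi> i > 0"
  unfolding cumul_def by (rule sum_pos) (auto intro!: pi_pos)

lemma cumul_M: "cumul \<pi> M = 1"
  using pi by (simp add: cumul_def prob_vector_def)

lemma sum_truncation_link:
  assumes "i \<in> {1..M}"
  shows "(\<Sum>k=1..M. truncation_link \<pi> i k * f k) = (\<Sum>k=1..i. \<pi> k * f k) / cumul \<pi> i"
proof -
  have "(\<Sum>k=1..M. truncation_link \<pi> i k * f k) = (\<Sum>k=1..i. truncation_link \<pi> i k * f k)"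
    using assms by (intro sum.mono_neutral_right) (auto simp: truncation_link_def)
  also have "\<dots> = (\<Sum>k=1..i. \<pi> k * f k) / cumul \<pi> i"
    unfolding sum_divide_distrib by (intro sum.cong) (auto simp: truncation_link_def)
  finally show ?thesis .
qed

lemma truncation_link_row_sum:
  assumes "i \<in> {1..M}"
  shows "(\<Sum>k=1..M. truncation_link \<pi> i k) = 1"
  using sum_truncation_link[OF assms, of "\<lambda>_. 1"] cumul_pos[OF assms]
  by (simp add: cumul_def[of \<pi> i])

text \<open>The measure \<open>\<pi>\<close> restricted to \<open>{1..i}\<close> and moved by one step of \<open>P\<close>, written in terms of the dual.\<close>

definition truncated_flow :: "nat \<Rightarrow> nat \<Rightarrow> real" where
  "truncated_flow i s = cumul \<pi> i * (\<Sum>j=1..M. birth_matrix M p i j * truncation_link \<pi> j s)"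

text \<open>The identity behind the definition of the matrix. Moving from \<open>k - 1\<close> to \<open>k\<close> enlarges the
  restricted measure by the single atom \<open>\<pi> k\<close>, so the difference of the flows must be the image of that
  atom. The remaining case distinction follows the shape of the matrix; in each case the identity is
  elementary once the quotients of consecutive \<open>H\<close> are treated as opaque numbers.\<close>

lemma trans_matrix_eq_flow_diff:
  assumes k: "k \<in> {1..M}" and s: "s \<in> {1..M}"
  shows "\<pi> k * trans_matrix M \<pi> p k s = truncated_flow k s - truncated_flow (k - 1) s"
proof -
  define H where "H = cumul \<pi>"
  have flow: "truncated_flow i s =
      (if i < M then (1 - p i) * (if s \<le> i then \<pi> s else 0)
                     + p i * (if s \<le> Suc i then \<pi> s * (H i / H (Suc i)) else 0)
       else \<pi> s)" if "i \<in> {1..M}" for i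
    using cumul_pos[OF that] s
    unfolding truncated_flow_def sum_birth_matrix[OF that] truncation_link_def H_def
    by (auto simp: field_simps)
  show ?thesis
  proof (cases "k = 1")
    case True
    have H: "H 1 = \<pi> 1" "H (Suc 1) = \<pi> 1 + \<pi> 2"
      using cumul_Suc[of \<pi> 0] cumul_Suc[of \<pi> 1] by (simp_all add: H_def numeral_2_eq_2 One_nat_def)
    have pos: "\<pi> 1 > 0" "\<pi> 2 > 0" using pi_pos[of 1] pi_pos[of 2] M by auto
    have flow0: "truncated_flow 0 s = 0" by (simp add: truncated_flow_def)
    consider "s = 1" | "s = 2" | "s > 2" using s by fastforce
    then show ?thesis
    proof cases
      case 1
      have P: "trans_matrix M \<pi> p 1 1 = 1 - \<pi> 2 / (\<pi> 1 + \<pi> 2) * p 1"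
        using M by (simp add: trans_matrix_def)
      have F: "truncated_flow 1 1 = (1 - p 1) * \<pi> 1 + p 1 * (\<pi> 1 * (\<pi> 1 / (\<pi> 1 + \<pi> 2)))"
        using True M flow[of 1] 1 H by simp
      have "\<pi> 1 * trans_matrix M \<pi> p 1 1 = truncated_flow 1 1"
        unfolding P F using pos by (simp add: field_simps)
      then show ?thesis using True 1 flow0 by simp
    next
      case 2
      have P: "trans_matrix M \<pi> p 1 2 = \<pi> 2 / (\<pi> 1 + \<pi> 2) * p 1"
        using M by (simp add: trans_matrix_def)
      have F: "truncated_flow 1 2 = p 1 * (\<pi> 2 * (\<pi> 1 / (\<pi> 1 + \<pi> 2)))"
        using True M flow[of 1] 2 H by simp
      have "\<pi> 1 * trans_matrix M \<pi> p 1 2 = truncated_flow 1 2"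
        unfolding P F using pos by (simp add: field_simps)
      then show ?thesis using True 2 flow0 by simp
    next
      case 3
      then have "trans_matrix M \<pi> p 1 s = 0"
        by (auto simp: trans_matrix_def Let_def)
      then show ?thesis using True M flow[of 1] 3 pos H flow0 by simp
    qed
  next
    case False
    then obtain l where l: "k = Suc l" "l \<in> {1..M}" "l < M" using k by (cases k) auto
    have pos: "H l > 0" "H k > 0" "\<pi> k > 0" "H k = H l + \<pi> k"
      using l(1) cumul_pos[OF l(2)] cumul_pos[OF k] pi_pos[OF k] cumul_Suc[of \<pi> l] by (simp_all add: H_def)
    show ?thesis
    proof (cases "k < M")
      case True
      have P: "trans_matrix M \<pi> p k s =
        (if s < k then \<pi> s / \<pi> k * (p l * (1 - H l / H k) - p k * (1 - H k / H (Suc k)))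
         else if s = k then 1 - p k * (1 - H k / H (Suc k)) - p l * (H l / H k)
         else if s = Suc k then p k * (H k / H (Suc k)) * (\<pi> (Suc k) / \<pi> k) else 0)"
        using True False k s l(1) by (simp add: trans_matrix_def H_def Let_def Suc_eq_plus1 del: add_Suc)
      obtain r r' where r: "H l / H k = r" "H k / H (Suc k) = r'" by blast
      have Fl: "truncated_flow l s =
          (if s < k then (1 - p l) * \<pi> s + p l * (\<pi> s * r) else if s = k then p l * (\<pi> s * r) else 0)"
        using flow[OF l(2)] l(1,3) r by auto
      have Fk: "truncated_flow k s =
          (if s \<le> k then (1 - p k) * \<pi> s + p k * (\<pi> s * r')
           else if s = Suc k then p k * (\<pi> s * r') else 0)"
        using flow[OF k] True r by auto
      have kl: "k - 1 = l" using l by simp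
      consider "s < k" | "s = k" | "s = Suc k" | "s > Suc k" by linarith
      then show ?thesis
        unfolding P Fk Fl kl r using pos(3) by cases (simp_all add: algebra_simps)
    next
      case F: False
      then have kM: "k = M" using k by auto
      \<comment> \<open>The last row has no upward step, and there \<open>H (M - 1) = 1 - \<pi> M\<close>.\<close>
      have H1: "H k = 1" using kM cumul_M by (simp add: H_def)
      have P: "trans_matrix M \<pi> p k s =
        (if s < k then p l * \<pi> s else 1 - p l + p l * \<pi> k)"
        using M False k s l kM by (auto simp: trans_matrix_def Let_def)
      have Hl: "H l = 1 - \<pi> k" using pos(4) H1 by simp
      have Fl: "truncated_flow l s = (if s < k then (1 - p l) * \<pi> s else 0) + p l * (\<pi> s * (1 - \<pi> k))"
        using flow[OF l(2)] l s kM H1 Hl by auto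
      have Fk: "truncated_flow k s = \<pi> s"
        using flow[OF k] kM by simp
      have kl: "k - 1 = l" using l by simp
      have "s < k \<or> s = k" using s kM by auto
      then show ?thesis
        unfolding P Fk Fl kl by (elim disjE) (simp_all add: algebra_simps)
    qed
  qed
qed

lemma sum_trans_matrix_eq_flow:
  assumes "i \<le> M" and s: "s \<in> {1..M}"
  shows "(\<Sum>k=1..i. \<pi> k * trans_matrix M \<pi> p k s) = truncated_flow i s"
  using assms(1)
proof (induction i)
  case (Suc i)
  then show ?case using trans_matrix_eq_flow_diff[of "Suc i" s] s by simp
qed (simp add: truncated_flow_def)

text \<open>\<open>\<Lambda> P = B \<Lambda>\<close>, the telescoped form of the previous identity.\<close>

lemma intertwining:
  assumes i: "i \<in> {1..M}" and s: "s \<in> {1..M}"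
  shows "(\<Sum>k=1..M. truncation_link \<pi> i k * trans_matrix M \<pi> p k s) =
    (\<Sum>j=1..M. birth_matrix M p i j * truncation_link \<pi> j s)"
  using cumul_pos[OF i] i s
  by (simp add: sum_truncation_link sum_trans_matrix_eq_flow truncated_flow_def)

lemma stationary_trans_matrix: "stationary M (trans_matrix M \<pi> p) \<pi>"
  using pi M cumul_M
  by (auto simp: stationary_def sum_trans_matrix_eq_flow truncated_flow_def sum_birth_matrix
      truncation_link_def)

text \<open>The total mass of the flow up to \<open>i\<close> is \<open>H i\<close>, because both the link and the birth chain
  preserve mass; the differences are therefore \<open>\<pi> k\<close>.\<close>

lemma sum_trans_matrix_row:
  assumes k: "k \<in> {1..M}"
  shows "(\<Sum>s=1..M. trans_matrix M \<pi> p k s) = 1"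
proof -
  have flow: "(\<Sum>s=1..M. truncated_flow i s) = cumul \<pi> i" if "i \<le> M" for i
  proof (cases "i = 0")
    case False
    then have "i \<in> {1..M}" using that by auto
    have "(\<Sum>s=1..M. truncated_flow i s) =
      cumul \<pi> i * (\<Sum>s=1..M. \<Sum>j=1..M. birth_matrix M p i j * truncation_link \<pi> j s)"
      by (simp add: truncated_flow_def sum_distrib_left)
    also have "(\<Sum>s=1..M. \<Sum>j=1..M. birth_matrix M p i j * truncation_link \<pi> j s)
      = (\<Sum>j=1..M. birth_matrix M p i j * (\<Sum>s=1..M. truncation_link \<pi> j s))"
      by (subst sum.swap) (simp add: sum_distrib_left)
    also have "\<dots> = (\<Sum>j=1..M. birth_matrix M p i j * 1)"
      by (intro sum.cong) (simp_all add: truncation_link_row_sum)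
    also have "\<dots> = 1" unfolding sum_birth_matrix[OF \<open>i \<in> {1..M}\<close>] by simp
    finally show ?thesis by simp
  qed (simp add: truncated_flow_def)
  have km: "k - 1 \<le> M" using k by auto
  have "\<pi> k * (\<Sum>s=1..M. trans_matrix M \<pi> p k s) = (\<Sum>s=1..M. truncated_flow k s - truncated_flow (k - 1) s)"
    unfolding sum_distrib_left by (intro sum.cong refl trans_matrix_eq_flow_diff k) auto
  also have "\<dots> = \<pi> k" using k flow[of k] flow[OF km] cumul_Suc[of \<pi> "k - 1"]
    by (simp add: sum_subtractf Suc_diff_1)
  finally show ?thesis using pi_pos[OF k] by simp
qed

section \<open>Separation through the dual\<close>

lemma init_dist_eq_link:
  assumes "s \<in> {1..M}"
  shows "init_dist M \<pi> a s = (\<Sum>i=1..M. a i * truncation_link \<pi> i s)"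
proof -
  have "(\<Sum>i=1..M. a i * truncation_link \<pi> i s) = (\<Sum>i=s..M. a i * truncation_link \<pi> i s)"
    using assms by (intro sum.mono_neutral_right) (auto simp: truncation_link_def)
  then show ?thesis
    by (simp add: init_dist_def sum_distrib_left truncation_link_def mult.commute)
qed

lemma prob_vector_init_dist:
  assumes a: "prob_vector M a"
  shows "prob_vector M (init_dist M \<pi> a)"
proof -
  have "(\<Sum>s=1..M. init_dist M \<pi> a s) = (\<Sum>s=1..M. \<Sum>i=1..M. a i * truncation_link \<pi> i s)"
    by (intro sum.cong init_dist_eq_link) auto
  also have "\<dots> = (\<Sum>i=1..M. a i * (\<Sum>s=1..M. truncation_link \<pi> i s))"
    by (subst sum.swap) (simp add: sum_distrib_left)
  also have "\<dots> = (\<Sum>i=1..M. a i)"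
    by (intro sum.cong) (simp_all add: truncation_link_row_sum)
  also have "\<dots> = 1" using a by (simp add: prob_vector_def)
  finally have "(\<Sum>s=1..M. init_dist M \<pi> a s) = 1" .
  moreover have "init_dist M \<pi> a k \<ge> 0" if "k \<in> {1..M}" for k
    unfolding init_dist_def using a that pi_pos cumul_pos
    by (intro mult_nonneg_nonneg sum_nonneg divide_nonneg_nonneg) (auto simp: prob_vector_def less_imp_le)
  ultimately show ?thesis by (simp add: prob_vector_def)
qed

text \<open>Iterated intertwining: \<open>a \<Lambda> P^n = a B^n \<Lambda>\<close>.\<close>

lemma dist_at_eq_dual:
  assumes "s \<in> {1..M}"
  shows "dist_at M (init_dist M \<pi> a) (trans_matrix M \<pi> p) n s =
    (\<Sum>i=1..M. dist_at M a (birth_matrix M p) n i * truncation_link \<pi> i s)"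
  using assms
proof (induction n arbitrary: s)
  case (Suc n)
  let ?b = "dist_at M a (birth_matrix M p)" and ?L = "truncation_link \<pi>" and ?P = "trans_matrix M \<pi> p"
  have "dist_at M (init_dist M \<pi> a) ?P (Suc n) s = (\<Sum>k=1..M. (\<Sum>i=1..M. ?b n i * ?L i k) * ?P k s)"
    using Suc.IH by simp
  also have "\<dots> = (\<Sum>i=1..M. ?b n i * (\<Sum>k=1..M. ?L i k * ?P k s))"
    unfolding sum_distrib_left sum_distrib_right by (subst sum.swap) (simp add: mult.assoc)
  also have "\<dots> = (\<Sum>i=1..M. ?b n i * (\<Sum>j=1..M. birth_matrix M p i j * ?L j s))"
    using Suc.prems by (intro sum.cong) (simp_all add: intertwining)
  also have "\<dots> = (\<Sum>j=1..M. (\<Sum>i=1..M. ?b n i * birth_matrix M p i j) * ?L j s)"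
    unfolding sum_distrib_left sum_distrib_right by (subst sum.swap) (simp add: mult.assoc)
  finally show ?case by simp
qed (simp add: init_dist_eq_link)

text \<open>The density of the law at time \<open>n\<close> with respect to \<open>\<pi>\<close> at the point \<open>e\<close> is the sum of
  \<open>b i / H i\<close> over \<open>i \<ge> e\<close>, where \<open>b\<close> is the law of the dual. It decreases in \<open>e\<close>, so it is smallest at
  \<open>e = M\<close>, where \<open>H M = 1\<close> leaves just \<open>b M\<close>.\<close>

lemma sep_eq_dual:
  assumes a: "prob_vector M a" and p: "\<And>k. k \<in> {1..M-1} \<Longrightarrow> 0 \<le> p k \<and> p k \<le> 1"
  shows "sep M (dist_at M (init_dist M \<pi> a) (trans_matrix M \<pi> p) n) \<pi> = 1 - dist_at M a (birth_matrix M p) n M"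
proof -
  let ?b = "dist_at M a (birth_matrix M p)" and ?\<mu> = "dist_at M (init_dist M \<pi> a) (trans_matrix M \<pi> p)"
  have b: "?b n i \<ge> 0" if "i \<in> {1..M}" for i
    using that
  proof (induction n arbitrary: i)
    case (Suc n)
    have "birth_matrix M p k i \<ge> 0" if "k \<in> {1..M}" for k
      using that p[of k] by (auto simp: birth_matrix_def)
    then show ?case using Suc by (auto intro!: sum_nonneg mult_nonneg_nonneg)
  qed (use a in \<open>simp add: prob_vector_def\<close>)
  have ratio: "?\<mu> n e / \<pi> e = (\<Sum>i=e..M. ?b n i / cumul \<pi> i)" if e: "e \<in> {1..M}" for e
  proof -
    have "?\<mu> n e = (\<Sum>i=e..M. ?b n i * truncation_link \<pi> i e)"
      unfolding dist_at_eq_dual[OF e]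
      using e by (intro sum.mono_neutral_right) (auto simp: truncation_link_def)
    also have "\<dots> / \<pi> e = (\<Sum>i=e..M. ?b n i / cumul \<pi> i)"
      unfolding sum_divide_distrib using pi_pos[OF e]
      by (intro sum.cong) (auto simp: truncation_link_def)
    finally show ?thesis .
  qed
  show ?thesis
    unfolding sep_def
  proof (rule Max_eqI)
    show "1 - ?b n M \<in> (\<lambda>e. 1 - ?\<mu> n e / \<pi> e) ` {1..M}"
      using M ratio[of M] cumul_M by (intro image_eqI[of _ _ M]) auto
    fix y assume "y \<in> (\<lambda>e. 1 - ?\<mu> n e / \<pi> e) ` {1..M}"
    then obtain e where e: "e \<in> {1..M}" "y = 1 - ?\<mu> n e / \<pi> e" by auto
    have "?b n M / cumul \<pi> M \<le> (\<Sum>i=e..M. ?b n i / cumul \<pi> i)"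
      using e b cumul_pos by (intro member_le_sum) (auto simp: less_imp_le intro!: divide_nonneg_nonneg)
    then show "y \<le> 1 - ?b n M" using e ratio cumul_M by simp
  qed simp
qed

section \<open>Eigenvalues\<close>

text \<open>The link is lower triangular with diagonal entries \<open>\<pi> i / H i > 0\<close>, hence invertible, and
  conjugates \<open>P\<close> into \<open>B\<close>.\<close>

lemma similar_birth_matrix: "similar_mat (to_mat M (trans_matrix M \<pi> p)) (to_mat M (birth_matrix M p))"
proof -
  let ?P = "to_mat M (trans_matrix M \<pi> p)" and ?B = "to_mat M (birth_matrix M p)"
    and ?L = "to_mat M (truncation_link \<pi>)"
  have C: "?P \<in> carrier_mat M M" "?B \<in> carrier_mat M M" "?L \<in> carrier_mat M M"
    by (simp_all add: to_mat_def)
  have "det ?L = prod_list (diag_mat ?L)"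
    by (rule det_lower_triangular[of M]) (auto simp: to_mat_def truncation_link_def)
  moreover have "0 \<notin> set (diag_mat ?L)"
  proof -
    have "\<pi> (Suc i) > 0" "cumul \<pi> (Suc i) > 0" if "i < M" for i
      using pi_pos[of "Suc i"] cumul_pos[of "Suc i"] that by auto
    then show ?thesis by (fastforce simp: diag_mat_def to_mat_def truncation_link_def)
  qed
  ultimately have "det ?L \<noteq> 0" by (simp add: prod_list_zero_iff)
  then obtain K where K: "K \<in> carrier_mat M M" "?L * K = 1\<^sub>m M" "K * ?L = 1\<^sub>m M"
    using det_non_zero_imp_unit[OF C(3), of "()"]
    unfolding Units_def ring_mat_def by auto
  have mult: "to_mat M f * to_mat M g = mat M M (\<lambda>(i, j). \<Sum>k=1..M. f (Suc i) k * g k (Suc j))" for f g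
  proof (rule eq_matI)
    fix i j assume "i < dim_row (mat M M (\<lambda>(i, j). \<Sum>k=1..M. f (Suc i) k * g k (Suc j)))"
      "j < dim_col (mat M M (\<lambda>(i, j). \<Sum>k=1..M. f (Suc i) k * g k (Suc j)))"
    then have "i < M" "j < M" by auto
    then have "(to_mat M f * to_mat M g) $$ (i, j) = (\<Sum>k<M. f (Suc i) (Suc k) * g (Suc k) (Suc j))"
      by (simp add: to_mat_def scalar_prod_def atLeast0LessThan)
    also have "\<dots> = (\<Sum>k=1..M. f (Suc i) k * g k (Suc j))"
      by (simp add: sum.atLeast1_atMost_eq One_nat_def)
    finally show "(to_mat M f * to_mat M g) $$ (i, j) = mat M M (\<lambda>(i, j). \<Sum>k=1..M. f (Suc i) k * g k (Suc j)) $$ (i, j)"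
      using \<open>i < M\<close> \<open>j < M\<close> by simp
  qed (auto simp: to_mat_def)
  have "?L * ?P = ?B * ?L"
    unfolding mult by (rule cong_mat) (simp_all add: intertwining)
  then have "K * ?B * ?L = K * (?L * ?P)"
    using assoc_mult_mat[OF K(1) C(2) C(3)] by simp
  also have "\<dots> = ?P"
    using assoc_mult_mat[OF K(1) C(3) C(1)] K(3) left_mult_one_mat[OF C(1)] by simp
  finally have "?P = K * ?B * ?L" by simp
  then show ?thesis using C(1,2,3) K by (intro similar_matI[of _ _ K ?L M]) simp_all
qed

lemma char_poly_trans_matrix:
  "char_poly (to_mat M (trans_matrix M \<pi> p)) = (\<Prod>k=1..M-1. [:-(1 - p k), 1:]) * [:-1, 1:]"
proof -
  let ?B = "to_mat M (birth_matrix M p)"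
  have "char_poly (to_mat M (trans_matrix M \<pi> p)) = char_poly ?B"
    by (rule char_poly_similar[OF similar_birth_matrix])
  also have "\<dots> = (\<Prod>x\<leftarrow>diag_mat ?B. [:- x, 1:])"
    by (rule char_poly_upper_triangular[of _ M]) (auto simp: to_mat_def birth_matrix_def)
  also have "diag_mat ?B = map (\<lambda>i. birth_matrix M p (Suc i) (Suc i)) [0..<M]"
    by (auto simp: diag_mat_def to_mat_def)
  also have "(\<Prod>x\<leftarrow>\<dots>. [:- x, 1:]) = (\<Prod>i<M. [:- birth_matrix M p (Suc i) (Suc i), 1:])"
    by (simp add: o_def atLeast0LessThan flip: prod.distinct_set_conv_list)
  also have "\<dots> = (\<Prod>i<M-1. [:- birth_matrix M p (Suc i) (Suc i), 1:]) * [:- 1, 1:]"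
    using M by (cases M) (auto simp: birth_matrix_def)
  also have "(\<Prod>i<M-1. [:- birth_matrix M p (Suc i) (Suc i), 1:]) = (\<Prod>i<M-1. [:- (1 - p (Suc i)), 1:])"
    by (intro prod.cong) (auto simp: birth_matrix_def)
  finally show ?thesis by (simp add: prod.atLeast1_atMost_eq One_nat_def)
qed

lemma spectrum_trans_matrix:
  "spectrum (map_mat complex_of_real (to_mat M (trans_matrix M \<pi> p))) =
      (\<lambda>k. complex_of_real (1 - p k)) ` {1..M-1} \<union> {1}"
proof -
  let ?P = "to_mat M (trans_matrix M \<pi> p)"
  have C: "?P \<in> carrier_mat M M" by (simp add: to_mat_def)
  interpret map_poly_comm_ring_hom complex_of_real ..
  have "poly (char_poly (map_mat complex_of_real ?P)) z =
    (\<Prod>k=1..M-1. z - complex_of_real (1 - p k)) * (z - 1)" for z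
    unfolding of_real_hom.char_poly_hom[OF C] char_poly_trans_matrix hom_mult hom_prod poly_mult poly_prod
    by (simp add: algebra_simps)
  then show ?thesis
    using C by (subst spectrum_root_char_poly[of _ M]) auto
qed

end

section \<open>Absorption times as sums of geometric variables\<close>

text \<open>The first trial either succeeds or postpones the same experiment by one unit of time. The
  equation also holds at \<open>q = 0\<close>, where the value \<open>\<infinity>\<close> is a fixed point of \<open>eSuc\<close>; this makes the
  degenerate parameters need no separate treatment later on.\<close>

lemma geo_pmf_unfold:
  assumes "0 \<le> q" "q \<le> 1"
  shows "geo_pmf q =
    bind_pmf (bernoulli_pmf q) (\<lambda>b. if b then return_pmf 1 else map_pmf eSuc (geo_pmf q))"
proof (cases "q = 0")
  case True
  have "bernoulli_pmf 0 = return_pmf False"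
    by (rule pmf_eqI) (auto split: split_indicator)
  then show ?thesis using True by (simp add: geo_pmf_def bind_return_pmf)
next
  case False
  let ?f = "\<lambda>n. enat (Suc n)"
  have "geo_pmf q = map_pmf ?f (bind_pmf (bernoulli_pmf q)
      (\<lambda>b. if b then return_pmf 0 else map_pmf Suc (geometric_pmf q)))"
    using False assms geometric_bind_pmf_unfold[of q] by (simp add: geo_pmf_def)
  also have "\<dots> = bind_pmf (bernoulli_pmf q)
      (\<lambda>b. if b then return_pmf (?f 0) else map_pmf eSuc (map_pmf ?f (geometric_pmf q)))"
    unfolding map_bind_pmf
    by (intro bind_pmf_cong) (auto simp: pmf.map_comp o_def eSuc_enat)
  also have "?f 0 = 1" by (simp add: one_enat_def)
  also have "map_pmf ?f (geometric_pmf q) = geo_pmf q" using False by (simp add: geo_pmf_def)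
  finally show ?thesis .
qed

lemma geo_sum_pmf_insert:
  assumes "finite J" "i \<notin> J"
  shows "geo_sum_pmf q (insert i J) =
    bind_pmf (geo_pmf (q i)) (\<lambda>x. map_pmf ((+) x) (geo_sum_pmf q J))"
proof -
  have "(\<Sum>j\<in>insert i J. (f(i := y)) j) = y + (\<Sum>j\<in>J. f j)" for f :: "nat \<Rightarrow> enat" and y
    using assms by (auto intro!: sum.cong)
  then show ?thesis
    unfolding geo_sum_pmf_def Pi_pmf_insert'[OF assms]
    by (simp add: map_bind_pmf pmf.map_comp o_def map_pmf_def[symmetric])
qed

text \<open>One unit of time of the sum: a success in the component \<open>i\<close> removes that component.\<close>

lemma geo_sum_pmf_unfold:
  assumes "finite J" "i \<notin> J" "0 \<le> q i" "q i \<le> 1"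
  shows "geo_sum_pmf q (insert i J) = bind_pmf (bernoulli_pmf (q i))
    (\<lambda>b. map_pmf eSuc (geo_sum_pmf q (if b then J else insert i J)))"
proof -
  let ?S = "geo_sum_pmf q J"
  have "geo_sum_pmf q (insert i J) = bind_pmf (bernoulli_pmf (q i))
    (\<lambda>b. bind_pmf (if b then return_pmf 1 else map_pmf eSuc (geo_pmf (q i))) (\<lambda>x. map_pmf ((+) x) ?S))"
    unfolding geo_sum_pmf_insert[OF assms(1,2)]
    by (subst geo_pmf_unfold[OF assms(3,4)]) (simp add: bind_assoc_pmf)
  also have "\<dots> = bind_pmf (bernoulli_pmf (q i))
    (\<lambda>b. map_pmf eSuc (geo_sum_pmf q (if b then J else insert i J)))"
  proof (intro bind_pmf_cong refl)
    fix b
    have 1: "(+) 1 = eSuc" and 2: "(+) (eSuc x) = eSuc \<circ> (+) x" for x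
      by (auto simp: fun_eq_iff plus_1_eSuc iadd_Suc)
    show "bind_pmf (if b then return_pmf 1 else map_pmf eSuc (geo_pmf (q i))) (\<lambda>x. map_pmf ((+) x) ?S)
      = map_pmf eSuc (geo_sum_pmf q (if b then J else insert i J))"
    proof (cases b)
      case True
      then show ?thesis by (simp add: bind_return_pmf 1)
    next
      case False
      then show ?thesis
        by (simp add: bind_map_pmf geo_sum_pmf_insert[OF assms(1,2)] map_bind_pmf 2 pmf.map_comp)
    qed
  qed
  finally show ?thesis .
qed

lemma prob_bind_bernoulli_pmf:
  assumes "0 \<le> q" "q \<le> 1"
  shows "measure_pmf.prob (bind_pmf (bernoulli_pmf q) f) X =
    q * measure_pmf.prob (f True) X + (1 - q) * measure_pmf.prob (f False) X"
proof -
  have "ennreal (measure_pmf.prob (bind_pmf (bernoulli_pmf q) f) X) =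
    ennreal (q * measure_pmf.prob (f True) X + (1 - q) * measure_pmf.prob (f False) X)"
    using assms
    by (simp add: measure_pmf.emeasure_eq_measure[symmetric] ennreal_mult mult.commute)
  then show ?thesis using assms by (subst (asm) ennreal_inj) auto
qed

text \<open>The recursion satisfied by the absorption probabilities of a birth chain at \<open>i\<close>, with the
  success probability \<open>q i\<close> as birth rate.\<close>

lemma geo_sum_pmf_cdf_Suc:
  assumes "finite J" "i \<notin> J" "0 \<le> q i" "q i \<le> 1"
  shows "measure_pmf.prob (geo_sum_pmf q (insert i J)) {..enat (Suc k)} =
    (1 - q i) * measure_pmf.prob (geo_sum_pmf q (insert i J)) {..enat k} +
    q i * measure_pmf.prob (geo_sum_pmf q J) {..enat k}"
proof -
  have "eSuc -` {..enat (Suc k)} = {..enat k}"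
    by (auto simp: eSuc_enat[symmetric])
  with assms show ?thesis
    by (subst (1) geo_sum_pmf_unfold[OF assms(1,2), of q], simp, simp)
      (subst prob_bind_bernoulli_pmf, simp_all add: algebra_simps)
qed

lemma geo_sum_pmf_cdf_0:
  assumes "finite J" "i \<notin> J" "0 \<le> q i" "q i \<le> 1"
  shows "measure_pmf.prob (geo_sum_pmf q (insert i J)) {..0} = 0"
proof -
  have "eSuc -` {..0} = {}" by auto
  with assms show ?thesis
    by (subst (1) geo_sum_pmf_unfold[OF assms(1,2), of q], simp, simp)
      (subst prob_bind_bernoulli_pmf, simp_all)
qed

lemma geo_sum_pmf_empty [simp]: "geo_sum_pmf q {} = return_pmf 0"
  by (simp add: geo_sum_pmf_def)

text \<open>The distribution function of the geometric sum solves the backward equation of the birth chain,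
  with the indicator of \<open>M\<close> as value at time 0, since every summand is at least 1. Trading one step
  of the backward equation for one step of the forward evolution moves \<open>k\<close> into \<open>n\<close>.\<close>

lemma dist_at_dual_top:
  assumes p: "\<And>k. k \<in> {1..M-1} \<Longrightarrow> 0 \<le> p k \<and> p k \<le> 1" and M: "M \<ge> 1"
  shows "dist_at M a (birth_matrix M p) (n + k) M =
    (\<Sum>i=1..M. dist_at M a (birth_matrix M p) n i * measure_pmf.prob (geo_sum_pmf p {i..M-1}) {..enat k})"
proof (induction k arbitrary: n)
  case 0
  have "measure_pmf.prob (geo_sum_pmf p {i..M-1}) {..0} = of_bool (i = M)" if i: "i \<in> {1..M}" for i
  proof (cases "i = M")
    case True
    then have "{i..M-1} = {}" using M by auto
    then show ?thesis using True by simp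
  next
    case False
    then have "{i..M-1} = insert i {Suc i..M-1}" using i by auto
    then show ?thesis using geo_sum_pmf_cdf_0[of "{Suc i..M-1}" i p] p[of i] i False by auto
  qed
  then have "(\<Sum>i=1..M. dist_at M a (birth_matrix M p) n i * measure_pmf.prob (geo_sum_pmf p {i..M-1}) {..0}) =
    (\<Sum>i=1..M. if i = M then dist_at M a (birth_matrix M p) n i else 0)"
    by (intro sum.cong) auto
  then show ?case using M by (simp add: zero_enat_def[symmetric])
next
  case (Suc k)
  let ?b = "dist_at M a (birth_matrix M p)"
  let ?d = "\<lambda>k i. measure_pmf.prob (geo_sum_pmf p {i..M-1}) {..enat k}"
  have backward: "?d (Suc k) i = (\<Sum>j=1..M. birth_matrix M p i j * ?d k j)" if i: "i \<in> {1..M}" for i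
  proof (cases "i = M")
    case True
    then have "{i..M-1} = {}" using M by auto
    then show ?thesis using True i by (simp add: sum_birth_matrix)
  next
    case False
    then have "{i..M-1} = insert i {Suc i..M-1}" using i by auto
    then show ?thesis
      using geo_sum_pmf_cdf_Suc[of "{Suc i..M-1}" i p k] p[of i] i False by (auto simp: sum_birth_matrix)
  qed
  have "?b (n + Suc k) M = (\<Sum>j=1..M. ?b (Suc n) j * ?d k j)"
    using Suc.IH[of "Suc n"] by simp
  also have "\<dots> = (\<Sum>i=1..M. ?b n i * (\<Sum>j=1..M. birth_matrix M p i j * ?d k j))"
    by (simp add: sum_distrib_left sum_distrib_right mult.assoc, subst sum.swap, rule refl)
  also have "\<dots> = (\<Sum>i=1..M. ?b n i * ?d (Suc k) i)"
    by (intro sum.cong) (simp_all add: backward)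
  finally show ?case .
qed

section \<open>Markov chains on path space\<close>

lemma markov_chain_measurable:
  assumes "markov_chain M \<nu> P \<Omega> X"
  shows "X n \<in> measurable \<Omega> (count_space UNIV)"
proof -
  have "X n \<in> measurable \<Omega> (count_space {1..M})" using assms by (simp add: markov_chain_def)
  then show ?thesis by (rule measurable_compose) simp
qed

lemma markov_chain_range:
  assumes "markov_chain M \<nu> P \<Omega> X" "\<omega> \<in> space \<Omega>"
  shows "X n \<omega> \<in> {1..M}"
proof -
  have "X n \<in> measurable \<Omega> (count_space {1..M})" using assms by (simp add: markov_chain_def)
  from measurable_space[OF this assms(2)] show ?thesis by simp
qed

lemma (in finite_measure) measure_partition:
  assumes "finite F" "\<And>\<omega>. \<omega> \<in> space M \<Longrightarrow> Q \<omega> \<Longrightarrow> f \<omega> \<in> F"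
    and "\<And>x. x \<in> F \<Longrightarrow> {\<omega>\<in>space M. Q \<omega> \<and> f \<omega> = x} \<in> sets M"
  shows "measure M {\<omega>\<in>space M. Q \<omega>} = (\<Sum>x\<in>F. measure M {\<omega>\<in>space M. Q \<omega> \<and> f \<omega> = x})"
proof -
  have "{\<omega>\<in>space M. Q \<omega>} = (\<Union>x\<in>F. {\<omega>\<in>space M. Q \<omega> \<and> f \<omega> = x})"
    using assms(2) by auto
  then show ?thesis
    using assms by (simp only:) (subst finite_measure_finite_Union, auto simp: disjoint_family_on_def)
qed

lemma markov_chain_path_Suc:
  assumes mc: "markov_chain M \<nu> P \<Omega> X" and s: "x (Suc n) \<in> {1..M}"
  shows "\<P>(\<omega> in \<Omega>. \<forall>i\<le>Suc n. X i \<omega> = x i) = \<P>(\<omega> in \<Omega>. \<forall>i\<le>n. X i \<omega> = x i) * P (x n) (x (Suc n))"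
proof -
  interpret prob_space \<Omega> using mc by (simp add: markov_chain_def)
  note [measurable] = markov_chain_measurable[OF mc]
  have split: "(\<forall>i\<le>Suc n. X i \<omega> = x i) \<longleftrightarrow> X (Suc n) \<omega> = x (Suc n) \<and> (\<forall>i\<le>n. X i \<omega> = x i)" for \<omega>
    by (auto simp: le_Suc_eq)
  show ?thesis
  proof (cases "\<P>(\<omega> in \<Omega>. \<forall>i\<le>n. X i \<omega> = x i) > 0")
    case True
    then have "\<P>(\<omega> in \<Omega>. X (Suc n) \<omega> = x (Suc n) \<bar> \<forall>i\<le>n. X i \<omega> = x i) = P (x n) (x (Suc n))"
      using mc s by (auto simp: markov_chain_def)
    then show ?thesis unfolding split using True by (simp add: cond_prob_def field_simps)
  next
    case False
    then have "\<P>(\<omega> in \<Omega>. \<forall>i\<le>n. X i \<omega> = x i) = 0"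
      using measure_nonneg[of \<Omega>] by (simp add: not_less order_antisym)
    moreover have "\<P>(\<omega> in \<Omega>. \<forall>i\<le>Suc n. X i \<omega> = x i) \<le> \<P>(\<omega> in \<Omega>. \<forall>i\<le>n. X i \<omega> = x i)"
      by (rule finite_measure_mono) auto
    ultimately show ?thesis by (simp add: order_antisym)
  qed
qed

text \<open>The defining property of the chain speaks about full paths, so events are split into the
  finitely many paths up to time \<open>n\<close>.\<close>

lemma markov_chain_path_decomposition:
  assumes mc: "markov_chain M \<nu> P \<Omega> X" and [measurable]: "Measurable.pred \<Omega> R"
  shows "\<P>(\<omega> in \<Omega>. R \<omega>) = (\<Sum>x\<in>{..n} \<rightarrow>\<^sub>E {1..M}. \<P>(\<omega> in \<Omega>. R \<omega> \<and> (\<forall>i\<le>n. X i \<omega> = x i)))"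
proof -
  interpret prob_space \<Omega> using mc by (simp add: markov_chain_def)
  note [measurable] = markov_chain_measurable[OF mc]
  define path where "path \<omega> = restrict (\<lambda>i. X i \<omega>) {..n}" for \<omega>
  have path_eq: "path \<omega> = x \<longleftrightarrow> (\<forall>i\<le>n. X i \<omega> = x i)" if "x \<in> {..n} \<rightarrow>\<^sub>E {1..M}" for x \<omega>
    using that by (auto simp: path_def fun_eq_iff PiE_def extensional_def restrict_def)
  have "\<P>(\<omega> in \<Omega>. R \<omega>) = (\<Sum>x\<in>{..n} \<rightarrow>\<^sub>E {1..M}. \<P>(\<omega> in \<Omega>. R \<omega> \<and> path \<omega> = x))"
  proof (rule measure_partition)
    show "path \<omega> \<in> {..n} \<rightarrow>\<^sub>E {1..M}" if "\<omega> \<in> space \<Omega>" for \<omega>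
      using markov_chain_range[OF mc that] by (auto simp: path_def)
  qed (auto simp: path_eq intro!: finite_PiE)
  then show ?thesis by (simp add: path_eq cong: sum.cong)
qed

text \<open>The Markov property for events \<open>Q\<close> that are, up to external randomisation, decided by the past:
  given the path, the conditional probability \<open>g\<close> of \<open>Q\<close> does not change when one more step is revealed.
  Both \<open>T = k\<close> for a randomised stopping time and the events \<open>k \<le> T\<close> of the construction below are of
  this kind.\<close>

lemma markov_step:
  assumes mc: "markov_chain M \<nu> P \<Omega> X" and [measurable]: "Measurable.pred \<Omega> Q"
    and Q: "\<And>x m. m \<in> {n, Suc n} \<Longrightarrow>
      \<P>(\<omega> in \<Omega>. Q \<omega> \<and> (\<forall>i\<le>m. X i \<omega> = x i)) = g x * \<P>(\<omega> in \<Omega>. \<forall>i\<le>m. X i \<omega> = x i)"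
    and s: "s \<in> {1..M}"
  shows "\<P>(\<omega> in \<Omega>. Q \<omega> \<and> X (Suc n) \<omega> = s) = (\<Sum>k=1..M. \<P>(\<omega> in \<Omega>. Q \<omega> \<and> X n \<omega> = k) * P k s)"
proof -
  interpret prob_space \<Omega> using mc by (simp add: markov_chain_def)
  note [measurable] = markov_chain_measurable[OF mc]
  define F where "F = ({..n} \<rightarrow>\<^sub>E {1..M})"
  note decomp = markov_chain_path_decomposition[OF mc, of _ n, folded F_def]
  have one: "\<P>(\<omega> in \<Omega>. (Q \<omega> \<and> X (Suc n) \<omega> = s) \<and> (\<forall>i\<le>n. X i \<omega> = x i)) =
      \<P>(\<omega> in \<Omega>. Q \<omega> \<and> (\<forall>i\<le>n. X i \<omega> = x i)) * P (x n) s" for x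
  proof -
    define y where "y = x(Suc n := s)"
    have "\<P>(\<omega> in \<Omega>. (Q \<omega> \<and> X (Suc n) \<omega> = s) \<and> (\<forall>i\<le>n. X i \<omega> = x i)) =
        \<P>(\<omega> in \<Omega>. Q \<omega> \<and> (\<forall>i\<le>Suc n. X i \<omega> = y i))"
      by (intro arg_cong[where f = prob] Collect_cong) (auto simp: y_def le_Suc_eq)
    also have "\<dots> = g y * (\<P>(\<omega> in \<Omega>. \<forall>i\<le>n. X i \<omega> = y i) * P (y n) (y (Suc n)))"
      using Q[of "Suc n" y] markov_chain_path_Suc[OF mc, of y n] s by (simp add: y_def)
    also have "\<dots> = \<P>(\<omega> in \<Omega>. Q \<omega> \<and> (\<forall>i\<le>n. X i \<omega> = y i)) * P (y n) (y (Suc n))"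
      using Q[of n y] by simp
    also have "\<dots> = \<P>(\<omega> in \<Omega>. Q \<omega> \<and> (\<forall>i\<le>n. X i \<omega> = x i)) * P (x n) s"
      by (auto simp: y_def intro!: arg_cong[where f = prob] Collect_cong)
    finally show ?thesis .
  qed
  have two: "\<P>(\<omega> in \<Omega>. Q \<omega> \<and> X n \<omega> = k) =
      (\<Sum>x\<in>F. if x n = k then \<P>(\<omega> in \<Omega>. Q \<omega> \<and> (\<forall>i\<le>n. X i \<omega> = x i)) else 0)" for k
  proof -
    have "\<P>(\<omega> in \<Omega>. Q \<omega> \<and> X n \<omega> = k) =
        (\<Sum>x\<in>F. \<P>(\<omega> in \<Omega>. (Q \<omega> \<and> X n \<omega> = k) \<and> (\<forall>i\<le>n. X i \<omega> = x i)))"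
      by (rule decomp) measurable
    also have "\<dots> = (\<Sum>x\<in>F. if x n = k then \<P>(\<omega> in \<Omega>. Q \<omega> \<and> (\<forall>i\<le>n. X i \<omega> = x i)) else 0)"
    proof (rule sum.cong[OF refl])
      fix x
      have "{\<omega>\<in>space \<Omega>. (Q \<omega> \<and> X n \<omega> = k) \<and> (\<forall>i\<le>n. X i \<omega> = x i)} =
          (if x n = k then {\<omega>\<in>space \<Omega>. Q \<omega> \<and> (\<forall>i\<le>n. X i \<omega> = x i)} else {})"
        by auto
      then show "\<P>(\<omega> in \<Omega>. (Q \<omega> \<and> X n \<omega> = k) \<and> (\<forall>i\<le>n. X i \<omega> = x i)) =
          (if x n = k then \<P>(\<omega> in \<Omega>. Q \<omega> \<and> (\<forall>i\<le>n. X i \<omega> = x i)) else 0)"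
        by simp
    qed
    finally show ?thesis .
  qed
  have "\<P>(\<omega> in \<Omega>. Q \<omega> \<and> X (Suc n) \<omega> = s) =
      (\<Sum>x\<in>F. \<P>(\<omega> in \<Omega>. Q \<omega> \<and> (\<forall>i\<le>n. X i \<omega> = x i)) * P (x n) s)"
    by (subst decomp) (simp_all only: one, measurable)
  also have "\<dots> = (\<Sum>x\<in>F. \<Sum>k=1..M. if x n = k then \<P>(\<omega> in \<Omega>. Q \<omega> \<and> (\<forall>i\<le>n. X i \<omega> = x i)) * P k s else 0)"
  proof (rule sum.cong[OF refl])
    fix x assume "x \<in> F"
    then have "x n \<in> {1..M}" by (auto simp: F_def)
    then show "\<P>(\<omega> in \<Omega>. Q \<omega> \<and> (\<forall>i\<le>n. X i \<omega> = x i)) * P (x n) s =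
      (\<Sum>k=1..M. if x n = k then \<P>(\<omega> in \<Omega>. Q \<omega> \<and> (\<forall>i\<le>n. X i \<omega> = x i)) * P k s else 0)"
      by simp
  qed
  also have "\<dots> = (\<Sum>k=1..M. \<P>(\<omega> in \<Omega>. Q \<omega> \<and> X n \<omega> = k) * P k s)"
    by (subst sum.swap) (auto simp: two sum_distrib_right intro!: sum.cong)
  finally show ?thesis .
qed

lemma markov_chain_dist_at:
  assumes mc: "markov_chain M \<nu> P \<Omega> X" and s: "s \<in> {1..M}"
  shows "\<P>(\<omega> in \<Omega>. X n \<omega> = s) = dist_at M \<nu> P n s"
  using s
proof (induction n arbitrary: s)
  case 0
  then show ?case using mc by (simp add: markov_chain_def)
next
  case (Suc n)
  have "\<P>(\<omega> in \<Omega>. True \<and> X (Suc n) \<omega> = s) = (\<Sum>k=1..M. \<P>(\<omega> in \<Omega>. True \<and> X n \<omega> = k) * P k s)"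
    by (rule markov_step[OF mc _ _ Suc.prems, where g = "\<lambda>_. 1"]) simp_all
  then show ?case using Suc.IH by simp
qed

section \<open>Strong stationary times and the separation bound\<close>

lemma randomized_stopping_time_path:
  assumes mc: "markov_chain M \<nu> P \<Omega> X" and T: "randomized_stopping_time \<Omega> X T" and kn: "k \<le> n"
  shows "\<P>(\<omega> in \<Omega>. T \<omega> = enat k \<and> (\<forall>i\<le>n. X i \<omega> = x i)) =
    \<P>(\<omega> in \<Omega>. T \<omega> = enat k \<bar> \<forall>i\<le>k. X i \<omega> = x i) * \<P>(\<omega> in \<Omega>. \<forall>i\<le>n. X i \<omega> = x i)"
proof -
  interpret prob_space \<Omega> using mc by (simp add: markov_chain_def)
  note [measurable] = markov_chain_measurable[OF mc]
  have [measurable]: "T \<in> measurable \<Omega> (count_space UNIV)" using T by (simp add: randomized_stopping_time_def)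
  show ?thesis
  proof (cases "\<P>(\<omega> in \<Omega>. \<forall>i\<le>n. X i \<omega> = x i) > 0")
    case True
    then have "\<P>(\<omega> in \<Omega>. T \<omega> = enat k \<bar> \<forall>i\<le>n. X i \<omega> = x i) =
        \<P>(\<omega> in \<Omega>. T \<omega> = enat k \<bar> \<forall>i\<le>k. X i \<omega> = x i)"
      using T kn by (auto simp: randomized_stopping_time_def)
    then show ?thesis using True by (simp add: cond_prob_def[of _ _ "\<lambda>\<omega>. \<forall>i\<le>n. X i \<omega> = x i"] field_simps)
  next
    case False
    then have "\<P>(\<omega> in \<Omega>. \<forall>i\<le>n. X i \<omega> = x i) = 0"
      using measure_nonneg[of \<Omega>] by (simp add: not_less order_antisym)
    moreover have "\<P>(\<omega> in \<Omega>. T \<omega> = enat k \<and> (\<forall>i\<le>n. X i \<omega> = x i)) \<le> \<P>(\<omega> in \<Omega>. \<forall>i\<le>n. X i \<omega> = x i)"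
      by (rule finite_measure_mono) auto
    ultimately show ?thesis by (simp add: order_antisym)
  qed
qed

text \<open>On \<open>T = \<infinity>\<close> the stopped process takes the value at the arbitrary time \<open>the_enat \<infinity>\<close>; measurability
  only uses that there are countably many times.\<close>

lemma measurable_stopped:
  assumes mc: "markov_chain M \<nu> P \<Omega> X" and T: "T \<in> measurable \<Omega> (count_space UNIV)"
  shows "(\<lambda>\<omega>. X (the_enat (T \<omega>)) \<omega>) \<in> measurable \<Omega> (count_space UNIV)"
proof (rule measurable_compose_countable[where g = "\<lambda>\<omega>. the_enat (T \<omega>)"])
  show "(\<lambda>\<omega>. the_enat (T \<omega>)) \<in> measurable \<Omega> (count_space UNIV)"
    using T by (rule measurable_compose) simp
qed (rule markov_chain_measurable[OF mc])

text \<open>Conditioning on \<open>T < \<infinity>\<close> is harmless because the event \<open>T = k\<close> implies it.\<close>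

lemma strong_stationary_time_joint:
  assumes mc: "markov_chain M \<nu> P \<Omega> X" and T: "strong_stationary_time M \<pi> \<Omega> X T" and e: "e \<in> {1..M}"
  shows "\<P>(\<omega> in \<Omega>. T \<omega> = enat k \<and> X k \<omega> = e) = \<P>(\<omega> in \<Omega>. T \<omega> = enat k) * \<pi> e"
proof -
  interpret prob_space \<Omega> using mc by (simp add: markov_chain_def)
  note [measurable] = markov_chain_measurable[OF mc]
  have Tm [measurable]: "T \<in> measurable \<Omega> (count_space UNIV)"
    using T by (simp add: strong_stationary_time_def randomized_stopping_time_def)
  define A where "A = {\<omega> \<in> space \<Omega>. T \<omega> < \<infinity>}"
  have [measurable]: "A \<in> sets \<Omega>" unfolding A_def by measurable
  show ?thesis
  proof (cases "prob A > 0")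
    case True
    define Q where "Q = uniform_measure \<Omega> A"
    define XT where "XT = (\<lambda>\<omega>. X (the_enat (T \<omega>)) \<omega>)"
    have eA: "emeasure \<Omega> A \<noteq> 0" "emeasure \<Omega> A \<noteq> \<infinity>" using True by (auto simp: emeasure_eq_measure)
    interpret Q: prob_space Q unfolding Q_def by (rule prob_space_uniform_measure[OF eA])
    have Qm: "measure Q B = prob (A \<inter> B) / prob A" if "B \<in> sets \<Omega>" for B
      unfolding Q_def using eA that by simp
    have XT_m [measurable]: "XT \<in> measurable \<Omega> (count_space UNIV)"
      unfolding XT_def by (rule measurable_stopped[OF mc Tm])
    have XT: "\<P>(\<omega> in Q. XT \<omega> = e) = \<pi> e" and indep: "Q.indep_var (count_space UNIV) T (count_space UNIV) (\<lambda>\<omega>. enat (XT \<omega>))"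
      using T True e by (auto simp: strong_stationary_time_def Let_def A_def Q_def XT_def)
    \<comment> \<open>Independence is a statement about two variables of one type, so \<open>X\<^sub>T\<close> enters through \<open>enat\<close>.\<close>
    have I: "Q.prob (a \<inter> b) = Q.prob a * Q.prob b"
      if "a \<in> sigma_sets (space Q) {T -` A \<inter> space Q | A. A \<in> sets (count_space UNIV)}"
        "b \<in> sigma_sets (space Q) {(\<lambda>\<omega>. enat (XT \<omega>)) -` A \<inter> space Q | A. A \<in> sets (count_space UNIV)}" for a b
      using indep that unfolding Q.indep_var_eq Q.indep_sets2_eq by blast
    have "Q.prob ((T -` {enat k} \<inter> space Q) \<inter> ((\<lambda>\<omega>. enat (XT \<omega>)) -` {enat e} \<inter> space Q)) =
        Q.prob (T -` {enat k} \<inter> space Q) * Q.prob ((\<lambda>\<omega>. enat (XT \<omega>)) -` {enat e} \<inter> space Q)"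
      by (intro I sigma_sets.Basic) auto
    also have "(\<lambda>\<omega>. enat (XT \<omega>)) -` {enat e} \<inter> space Q = {\<omega> \<in> space Q. XT \<omega> = e}" by auto
    also have "T -` {enat k} \<inter> space Q = {\<omega> \<in> space \<Omega>. T \<omega> = enat k}" by (auto simp: Q_def)
    also have "{\<omega> \<in> space \<Omega>. T \<omega> = enat k} \<inter> {\<omega> \<in> space Q. XT \<omega> = e} =
        {\<omega> \<in> space \<Omega>. T \<omega> = enat k \<and> X k \<omega> = e}"
      by (auto simp: Q_def XT_def)
    finally have "prob (A \<inter> {\<omega> \<in> space \<Omega>. T \<omega> = enat k \<and> X k \<omega> = e}) / prob A =
        prob (A \<inter> {\<omega> \<in> space \<Omega>. T \<omega> = enat k}) / prob A * \<pi> e"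
      by (simp add: XT Qm)
    moreover have "A \<inter> {\<omega> \<in> space \<Omega>. T \<omega> = enat k \<and> X k \<omega> = e} = {\<omega> \<in> space \<Omega>. T \<omega> = enat k \<and> X k \<omega> = e}"
      "A \<inter> {\<omega> \<in> space \<Omega>. T \<omega> = enat k} = {\<omega> \<in> space \<Omega>. T \<omega> = enat k}"
      by (auto simp: A_def)
    ultimately show ?thesis using True by (simp add: field_simps)
  next
    case False
    have "prob {\<omega> \<in> space \<Omega>. T \<omega> = enat k \<and> X k \<omega> = e} \<le> prob A"
      "prob {\<omega> \<in> space \<Omega>. T \<omega> = enat k} \<le> prob A"
      by (auto intro!: finite_measure_mono simp: A_def)
    moreover have "prob A = 0" using False by (simp add: zero_less_measure_iff)
    ultimately show ?thesis by (simp add: measure_le_0_iff)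
  qed
qed

text \<open>On \<open>T = k\<close> the chain has law \<open>\<pi>\<close> at time \<open>k\<close>, and the Markov step keeps it there because, given
  the path up to \<open>k\<close>, the decision to stop is independent of later states.\<close>

lemma strong_stationary_time_persists:
  assumes mc: "markov_chain M \<nu> P \<Omega> X" and T: "strong_stationary_time M \<pi> \<Omega> X T"
    and st: "stationary M P \<pi>" and e: "e \<in> {1..M}"
  shows "\<P>(\<omega> in \<Omega>. T \<omega> = enat k \<and> X (k + n) \<omega> = e) = \<P>(\<omega> in \<Omega>. T \<omega> = enat k) * \<pi> e"
  using e
proof (induction n arbitrary: e)
  case 0
  then show ?case using strong_stationary_time_joint[OF mc T] by simp
next
  case (Suc n)
  have Tm [measurable]: "T \<in> measurable \<Omega> (count_space UNIV)" and R: "randomized_stopping_time \<Omega> X T"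
    using T by (simp_all add: strong_stationary_time_def randomized_stopping_time_def)
  have "\<P>(\<omega> in \<Omega>. T \<omega> = enat k \<and> X (Suc (k + n)) \<omega> = e) =
      (\<Sum>l=1..M. \<P>(\<omega> in \<Omega>. T \<omega> = enat k \<and> X (k + n) \<omega> = l) * P l e)"
    by (rule markov_step[OF mc _ randomized_stopping_time_path[OF mc R] Suc.prems]) auto
  also have "\<dots> = (\<Sum>l=1..M. \<P>(\<omega> in \<Omega>. T \<omega> = enat k) * \<pi> l * P l e)"
    by (intro sum.cong) (simp_all add: Suc.IH)
  also have "\<dots> = \<P>(\<omega> in \<Omega>. T \<omega> = enat k) * (\<Sum>l=1..M. \<pi> l * P l e)"
    unfolding sum_distrib_left by (simp only: mult.assoc)
  also have "(\<Sum>l=1..M. \<pi> l * P l e) = \<pi> e" using st Suc.prems by (simp add: stationary_def)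
  finally show ?case by simp
qed

text \<open>The law at time \<open>k\<close> dominates its part on \<open>T \<le> k\<close>, which by the previous lemma is the multiple
  \<open>P(T \<le> k) \<pi>\<close>. Hence \<open>P(T > k)\<close> is at least \<open>1 - \<mu> e / \<pi> e\<close> for every state \<open>e\<close>.\<close>

theorem sep_le_strong_stationary_time_tail:
  assumes mc: "markov_chain M \<nu> P \<Omega> X" and T: "strong_stationary_time M \<pi> \<Omega> X T"
    and st: "stationary M P \<pi>" and pos: "\<And>e. e \<in> {1..M} \<Longrightarrow> \<pi> e > 0" and M: "M \<ge> 1"
  shows "sep M (dist_at M \<nu> P k) \<pi> \<le> \<P>(\<omega> in \<Omega>. T \<omega> > enat k)"
proof -
  interpret prob_space \<Omega> using mc by (simp add: markov_chain_def)
  note [measurable] = markov_chain_measurable[OF mc]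
  have Tm [measurable]: "T \<in> measurable \<Omega> (count_space UNIV)"
    using T by (simp add: strong_stationary_time_def randomized_stopping_time_def)
  have fin: "T \<omega> \<in> enat ` {..k}" if "\<not> T \<omega> > enat k" for \<omega>
    using that by (cases "T \<omega>") auto
  have "1 - dist_at M \<nu> P k e / \<pi> e \<le> \<P>(\<omega> in \<Omega>. T \<omega> > enat k)" if e: "e \<in> {1..M}" for e
  proof -
    have "(1 - \<P>(\<omega> in \<Omega>. T \<omega> > enat k)) * \<pi> e = \<P>(\<omega> in \<Omega>. \<not> T \<omega> > enat k) * \<pi> e"
      by (subst prob_neg) auto
    also have "\<P>(\<omega> in \<Omega>. \<not> T \<omega> > enat k) =
        (\<Sum>t\<in>enat ` {..k}. \<P>(\<omega> in \<Omega>. \<not> T \<omega> > enat k \<and> T \<omega> = t))"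
      by (rule measure_partition) (auto simp: fin)
    also have "\<dots> = (\<Sum>j\<le>k. \<P>(\<omega> in \<Omega>. T \<omega> = enat j))"
      by (subst sum.reindex) (auto simp: inj_on_def intro!: sum.cong arg_cong[where f = prob])
    also have "\<dots> * \<pi> e = (\<Sum>j\<le>k. \<P>(\<omega> in \<Omega>. T \<omega> = enat j \<and> X k \<omega> = e))"
      unfolding sum_distrib_right
    proof (rule sum.cong[OF refl])
      fix j assume "j \<in> {..k}"
      then show "\<P>(\<omega> in \<Omega>. T \<omega> = enat j) * \<pi> e = \<P>(\<omega> in \<Omega>. T \<omega> = enat j \<and> X k \<omega> = e)"
        using strong_stationary_time_persists[OF mc T st e, of j "k - j"] by simp
    qed
    also have "\<dots> = (\<Sum>t\<in>enat ` {..k}. \<P>(\<omega> in \<Omega>. (\<not> T \<omega> > enat k \<and> X k \<omega> = e) \<and> T \<omega> = t))"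
      by (subst sum.reindex) (auto simp: inj_on_def intro!: sum.cong arg_cong[where f = prob])
    also have "\<dots> = \<P>(\<omega> in \<Omega>. \<not> T \<omega> > enat k \<and> X k \<omega> = e)"
      by (rule measure_partition[symmetric]) (auto simp: fin)
    also have "\<dots> \<le> \<P>(\<omega> in \<Omega>. X k \<omega> = e)"
      by (rule finite_measure_mono) auto
    also have "\<dots> = dist_at M \<nu> P k e" by (rule markov_chain_dist_at[OF mc e])
    finally show ?thesis using pos[OF e] by (simp add: field_simps)
  qed
  then show ?thesis unfolding sep_def using M by (subst Max_le_iff) auto
qed

text \<open>For countable ranges the level sets generate everything, and together with the empty set they
  are closed under intersections.\<close>

lemma (in prob_space) indep_var_countableI:
  fixes X Y :: "'a \<Rightarrow> 'b :: countable"
  assumes [measurable]: "X \<in> measurable M (count_space UNIV)" "Y \<in> measurable M (count_space UNIV)"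
    and joint: "\<And>x y. \<P>(\<omega> in M. X \<omega> = x \<and> Y \<omega> = y) = \<P>(\<omega> in M. X \<omega> = x) * \<P>(\<omega> in M. Y \<omega> = y)"
  shows "indep_var (count_space UNIV) X (count_space UNIV) Y"
proof -
  have gen: "sigma_sets (space M) {f -` A \<inter> space M |A. A \<in> sets (count_space UNIV)} \<subseteq>
      sigma_sets (space M) (insert {} (range (\<lambda>x. {\<omega> \<in> space M. f \<omega> = x})))"
    for f :: "'a \<Rightarrow> 'b"
  proof (rule sigma_sets_mono, safe)
    fix A :: "'b set"
    have "f -` A \<inter> space M = \<Union>((\<lambda>x. {\<omega> \<in> space M. f \<omega> = x}) ` A)" by auto
    also have "\<dots> \<in> sigma_sets (space M) (insert {} (range (\<lambda>x. {\<omega> \<in> space M. f \<omega> = x})))"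
      by (rule sigma_sets_UNION) (auto intro!: sigma_sets.Basic)
    finally show "f -` A \<inter> space M \<in> sigma_sets (space M) (insert {} (range (\<lambda>x. {\<omega> \<in> space M. f \<omega> = x})))" .
  qed
  have stable: "Int_stable (insert {} (range (\<lambda>x. {\<omega> \<in> space M. f \<omega> = x})))" for f :: "'a \<Rightarrow> 'b"
    by (auto simp: Int_stable_def)
  have "indep_set (insert {} (range (\<lambda>x. {\<omega> \<in> space M. X \<omega> = x})))
                  (insert {} (range (\<lambda>y. {\<omega> \<in> space M. Y \<omega> = y})))"
  proof (rule indep_setI)
    have "{\<omega> \<in> space M. X \<omega> = x} \<inter> {\<omega> \<in> space M. Y \<omega> = y} = {\<omega> \<in> space M. X \<omega> = x \<and> Y \<omega> = y}" for x y
      by auto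
    then show "prob (a \<inter> b) = prob a * prob b"
      if "a \<in> insert {} (range (\<lambda>x. {\<omega> \<in> space M. X \<omega> = x}))"
        "b \<in> insert {} (range (\<lambda>y. {\<omega> \<in> space M. Y \<omega> = y}))" for a b
      using that joint by auto
  qed auto
  from indep_set_sigma_sets[OF this stable stable] gen[of X] gen[of Y]
  have "indep_set (sigma_sets (space M) {X -` A \<inter> space M |A. A \<in> sets (count_space UNIV)})
                  (sigma_sets (space M) {Y -` A \<inter> space M |A. A \<in> sets (count_space UNIV)})"
    unfolding indep_sets2_eq by blast
  then show ?thesis unfolding indep_var_eq by simp
qed

text \<open>Converse of \<open>strong_stationary_time_joint\<close>: adding the joint probabilities over all finite times
  gives \<open>P(X\<^sub>T = e, T < \<infinity>) = P(T < \<infinity>) \<pi> e\<close>, so the joint law given \<open>T < \<infinity>\<close> is a product.\<close>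

lemma strong_stationary_timeI:
  assumes mc: "markov_chain M \<nu> P \<Omega> X" and T: "randomized_stopping_time \<Omega> X T"
    and joint: "\<And>k e. e \<in> {1..M} \<Longrightarrow>
      \<P>(\<omega> in \<Omega>. T \<omega> = enat k \<and> X k \<omega> = e) = \<P>(\<omega> in \<Omega>. T \<omega> = enat k) * \<pi> e"
  shows "strong_stationary_time M \<pi> \<Omega> X T"
proof -
  interpret prob_space \<Omega> using mc by (simp add: markov_chain_def)
  note [measurable] = markov_chain_measurable[OF mc]
  have Tm [measurable]: "T \<in> measurable \<Omega> (count_space UNIV)"
    using T by (simp add: randomized_stopping_time_def)
  define A where "A = {\<omega> \<in> space \<Omega>. T \<omega> < \<infinity>}"
  define Q where "Q = uniform_measure \<Omega> A"
  define XT where "XT = (\<lambda>\<omega>. X (the_enat (T \<omega>)) \<omega>)"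
  have [measurable]: "A \<in> sets \<Omega>" unfolding A_def by measurable
  have XT_m [measurable]: "XT \<in> measurable \<Omega> (count_space UNIV)"
    unfolding XT_def by (rule measurable_stopped[OF mc Tm])
  have "(\<forall>e\<in>{1..M}. \<P>(\<omega> in Q. XT \<omega> = e) = \<pi> e) \<and>
        prob_space.indep_var Q (count_space UNIV) T (count_space UNIV) (\<lambda>\<omega>. enat (XT \<omega>))" if "prob A > 0"
  proof -
    have eA: "emeasure \<Omega> A \<noteq> 0" "emeasure \<Omega> A \<noteq> \<infinity>" using that by (auto simp: emeasure_eq_measure)
    interpret Q: prob_space Q unfolding Q_def by (rule prob_space_uniform_measure[OF eA])
    have Qm: "measure Q B = prob (A \<inter> B) / prob A" if "B \<in> sets \<Omega>" for B
      unfolding Q_def using eA that by simp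
    have space_Q [simp]: "space Q = space \<Omega>" by (simp add: Q_def)
    have sets_Q [simp, measurable_cong]: "sets Q = sets \<Omega>" by (simp add: Q_def)
    have range: "XT \<omega> \<in> {1..M}" if "\<omega> \<in> space \<Omega>" for \<omega>
      unfolding XT_def by (rule markov_chain_range[OF mc that])
    have XT: "\<P>(\<omega> in Q. XT \<omega> = e) = \<pi> e" if e: "e \<in> {1..M}" for e
    proof -
      have "(\<lambda>k. \<P>(\<omega> in \<Omega>. T \<omega> = enat k \<and> X k \<omega> = e)) sums
          prob (\<Union>k. {\<omega> \<in> space \<Omega>. T \<omega> = enat k \<and> X k \<omega> = e})"
        by (rule finite_measure_UNION) (auto simp: disjoint_family_on_def)
      also have "(\<Union>k. {\<omega> \<in> space \<Omega>. T \<omega> = enat k \<and> X k \<omega> = e}) = A \<inter> {\<omega> \<in> space \<Omega>. XT \<omega> = e}"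
        by (auto simp: A_def XT_def)
      finally have 1: "(\<lambda>k. \<P>(\<omega> in \<Omega>. T \<omega> = enat k) * \<pi> e) sums prob (A \<inter> {\<omega> \<in> space \<Omega>. XT \<omega> = e})"
        by (simp add: joint[OF e])
      have "(\<lambda>k. \<P>(\<omega> in \<Omega>. T \<omega> = enat k)) sums prob (\<Union>k. {\<omega> \<in> space \<Omega>. T \<omega> = enat k})"
        by (rule finite_measure_UNION) (auto simp: disjoint_family_on_def)
      also have "(\<Union>k. {\<omega> \<in> space \<Omega>. T \<omega> = enat k}) = A"
        by (auto simp: A_def)
      finally have "(\<lambda>k. \<P>(\<omega> in \<Omega>. T \<omega> = enat k) * \<pi> e) sums (prob A * \<pi> e)"
        by (rule sums_mult2)
      with 1 have "prob (A \<inter> {\<omega> \<in> space \<Omega>. XT \<omega> = e}) = prob A * \<pi> e"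
        by (rule sums_unique2)
      then show ?thesis using that \<open>prob A > 0\<close> by (simp add: Qm)
    qed
    have "\<P>(\<omega> in Q. T \<omega> = t \<and> enat (XT \<omega>) = y) = \<P>(\<omega> in Q. T \<omega> = t) * \<P>(\<omega> in Q. enat (XT \<omega>) = y)" for t y
    proof (cases t)
      case t: (enat k)
      show ?thesis
      proof (cases "y \<in> enat ` {1..M}")
        case True
        then obtain e where e: "y = enat e" "e \<in> {1..M}" by auto
        have "A \<inter> {\<omega> \<in> space \<Omega>. T \<omega> = t \<and> XT \<omega> = e} = {\<omega> \<in> space \<Omega>. T \<omega> = enat k \<and> X k \<omega> = e}"
          "A \<inter> {\<omega> \<in> space \<Omega>. T \<omega> = t} = {\<omega> \<in> space \<Omega>. T \<omega> = enat k}"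
          by (auto simp: A_def XT_def t)
        then have "\<P>(\<omega> in Q. T \<omega> = t \<and> XT \<omega> = e) = \<P>(\<omega> in Q. T \<omega> = t) * \<pi> e"
          by (simp add: Qm joint[OF e(2)])
        then show ?thesis using XT[OF e(2)] e(1) by simp
      next
        case False
        then have "{\<omega> \<in> space \<Omega>. enat (XT \<omega>) = y} = {}" "{\<omega> \<in> space \<Omega>. T \<omega> = t \<and> enat (XT \<omega>) = y} = {}"
          using range by auto
        then show ?thesis by (simp only: space_Q measure_empty mult_zero_right)
      qed
    next
      case infinity
      then have "A \<inter> {\<omega> \<in> space \<Omega>. T \<omega> = t \<and> enat (XT \<omega>) = y} = {}" "A \<inter> {\<omega> \<in> space \<Omega>. T \<omega> = t} = {}"
        by (auto simp: A_def)
      then show ?thesis by (simp add: Qm)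
    qed
    then have "Q.indep_var (count_space UNIV) T (count_space UNIV) (\<lambda>\<omega>. enat (XT \<omega>))"
      by (intro Q.indep_var_countableI) (auto simp: measurable_cong_sets[OF sets_Q refl])
    with XT show ?thesis by blast
  qed
  then show ?thesis
    using T by (simp add: strong_stationary_time_def Let_def A_def Q_def XT_def)
qed

section \<open>Stopping with prescribed hazards\<close>

lemma prob_space_uniform: "prob_space (uniform_measure lborel {0..1::real})"
  by (rule prob_space_uniform_measure) auto

lemma measure_enlarge_Times:
  assumes "prob_space \<Omega>" "A \<in> sets \<Omega>" "B \<in> sets borel"
  shows "measure (enlarge \<Omega>) (A \<times> B) = measure \<Omega> A * measure (uniform_measure lborel {0..1}) B"
proof -
  interpret \<Omega>: prob_space \<Omega> by fact
  interpret U: prob_space "uniform_measure lborel {0..1::real}" by (rule prob_space_uniform)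
  show ?thesis unfolding enlarge_def
    using assms by (simp add: measure_def U.emeasure_pair_measure_Times enn2real_mult)
qed

lemma prob_space_enlarge:
  assumes "prob_space \<Omega>"
  shows "prob_space (enlarge \<Omega>)"
  unfolding enlarge_def by (intro prob_space_pair assms prob_space_uniform)

lemma space_enlarge: "space (enlarge \<Omega>) = space \<Omega> \<times> UNIV"
  by (simp add: enlarge_def space_pair_measure)

lemma measure_uniform_lessThan:
  assumes "0 \<le> c" "c \<le> 1"
  shows "measure (uniform_measure lborel {0..1}) {u. u < c} = (c :: real)"
proof -
  have "{0..1} \<inter> {u. u < c} = {0..<c}" using assms by auto
  then show ?thesis using assms by simp
qed

lemma measure_enlarge_fst:
  assumes "prob_space \<Omega>" "Measurable.pred \<Omega> Q"
  shows "\<P>(z in enlarge \<Omega>. Q (fst z)) = \<P>(\<omega> in \<Omega>. Q \<omega>)"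
proof -
  interpret U: prob_space "uniform_measure lborel {0..1::real}" by (rule prob_space_uniform)
  have "{z \<in> space (enlarge \<Omega>). Q (fst z)} = {\<omega>\<in>space \<Omega>. Q \<omega>} \<times> UNIV"
    by (auto simp: space_enlarge)
  then show ?thesis
    using measure_enlarge_Times[OF assms(1), of "{\<omega>\<in>space \<Omega>. Q \<omega>}" UNIV] assms(2) U.prob_space by simp
qed

lemma markov_chain_lift_process:
  assumes mc: "markov_chain M \<nu> P \<Omega> X"
  shows "markov_chain M \<nu> P (enlarge \<Omega>) (lift_process X)"
proof -
  have \<Omega>: "prob_space \<Omega>" using mc by (simp add: markov_chain_def)
  note [measurable] = markov_chain_measurable[OF mc]
  have fst_m: "fst \<in> measurable (enlarge \<Omega>) \<Omega>" unfolding enlarge_def by simp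
  have X: "X n \<in> measurable \<Omega> (count_space {1..M})" for n using mc by (simp add: markov_chain_def)
  have pr: "\<P>(z in enlarge \<Omega>. Q (fst z)) = \<P>(\<omega> in \<Omega>. Q \<omega>)" if "Measurable.pred \<Omega> Q" for Q
    by (rule measure_enlarge_fst[OF \<Omega> that])
  show ?thesis
    unfolding markov_chain_def lift_process_def
  proof (intro conjI allI ballI impI)
    show "prob_space (enlarge \<Omega>)" by (rule prob_space_enlarge[OF \<Omega>])
    show "X n \<circ> fst \<in> measurable (enlarge \<Omega>) (count_space {1..M})" for n
      by (rule measurable_comp[OF fst_m X])
    show "\<P>(z in enlarge \<Omega>. (X 0 \<circ> fst) z = k) = \<nu> k" if "k \<in> {1..M}" for k
      using pr[of "\<lambda>\<omega>. X 0 \<omega> = k"] mc that by (simp add: markov_chain_def)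
    fix n x s assume s: "s \<in> {1..M}" and pos: "\<P>(z in enlarge \<Omega>. \<forall>i\<le>n. (X i \<circ> fst) z = x i) > 0"
    have 1: "\<P>(z in enlarge \<Omega>. \<forall>i\<le>n. (X i \<circ> fst) z = x i) = \<P>(\<omega> in \<Omega>. \<forall>i\<le>n. X i \<omega> = x i)"
      using pr[of "\<lambda>\<omega>. \<forall>i\<le>n. X i \<omega> = x i"] by simp
    have 2: "\<P>(z in enlarge \<Omega>. (X (Suc n) \<circ> fst) z = s \<and> (\<forall>i\<le>n. (X i \<circ> fst) z = x i)) =
        \<P>(\<omega> in \<Omega>. X (Suc n) \<omega> = s \<and> (\<forall>i\<le>n. X i \<omega> = x i))"
      using pr[of "\<lambda>\<omega>. X (Suc n) \<omega> = s \<and> (\<forall>i\<le>n. X i \<omega> = x i)"] by simp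
    have "\<P>(\<omega> in \<Omega>. X (Suc n) \<omega> = s \<bar> \<forall>i\<le>n. X i \<omega> = x i) = P (x n) s"
      using mc s pos unfolding 1 markov_chain_def by blast
    then show "\<P>(z in enlarge \<Omega>. (X (Suc n) \<circ> fst) z = s \<bar> \<forall>i\<le>n. (X i \<circ> fst) z = x i) = P (x n) s"
      unfolding cond_prob_def 1 2 .
  qed
qed

text \<open>\<open>h k e\<close> is the probability of stopping at time \<open>k\<close> in state \<open>e\<close>, if not stopped before; the
  product is the conditional probability of not having stopped before time \<open>k\<close>, given the path \<open>x\<close>.\<close>

definition survival :: "(nat \<Rightarrow> nat \<Rightarrow> real) \<Rightarrow> (nat \<Rightarrow> nat) \<Rightarrow> nat \<Rightarrow> real" where
  "survival h x k = (\<Prod>j<k. 1 - h j (x j))"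

text \<open>The inverse transform of the conditional survival function, applied to the uniform second
  component. The infimum over the empty set is \<open>\<infinity>\<close>.\<close>

definition hazard_time :: "(nat \<Rightarrow> nat \<Rightarrow> real) \<Rightarrow> (nat \<Rightarrow> 'w \<Rightarrow> nat) \<Rightarrow> 'w \<times> real \<Rightarrow> enat" where
  "hazard_time h X z = Inf (enat ` {k. survival h (\<lambda>j. X j (fst z)) (Suc k) \<le> snd z})"

context
  fixes h :: "nat \<Rightarrow> nat \<Rightarrow> real"
  assumes h: "\<And>k e. 0 \<le> h k e \<and> h k e \<le> 1"
begin

lemma survival_bounds: "0 \<le> survival h x k" "survival h x k \<le> 1"
  unfolding survival_def using h by (auto intro!: prod_nonneg prod_le_1)

lemma survival_antimono:
  assumes "j \<le> k"
  shows "survival h x k \<le> survival h x j"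
  using assms
proof (induction rule: dec_induct)
  case (step n)
  have "survival h x (Suc n) \<le> survival h x n"
    using survival_bounds(1)[of x n] h[of n "x n"] by (simp add: survival_def mult_left_le)
  with step show ?case by simp
qed simp

text \<open>The disjunct \<open>k = 0\<close> only matters on the null set where the second component is at least 1.\<close>

lemma enat_le_hazard_time_iff:
  "enat k \<le> hazard_time h X z \<longleftrightarrow> k = 0 \<or> snd z < survival h (\<lambda>j. X j (fst z)) k"
proof -
  let ?S = "survival h (\<lambda>j. X j (fst z))"
  have "enat k \<le> hazard_time h X z \<longleftrightarrow> (\<forall>j. ?S (Suc j) \<le> snd z \<longrightarrow> k \<le> j)"
    by (auto simp: hazard_time_def le_Inf_iff)
  also have "\<dots> \<longleftrightarrow> (\<forall>j<k. snd z < ?S (Suc j))" by (meson not_le)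
  also have "\<dots> \<longleftrightarrow> k = 0 \<or> snd z < ?S k"
  proof (cases k)
    case (Suc l)
    have "snd z < ?S (Suc j)" if "snd z < ?S k" "j < k" for j
      using survival_antimono[of "Suc j" k "\<lambda>j. X j (fst z)"] that by simp
    then show ?thesis using Suc by auto
  qed simp
  finally show ?thesis .
qed

context
  fixes M :: nat and \<nu> :: "nat \<Rightarrow> real" and P \<Omega> and X :: "nat \<Rightarrow> 'w \<Rightarrow> nat"
  assumes mc: "markov_chain M \<nu> P \<Omega> X"
begin

lemma measurable_hazard_time: "hazard_time h X \<in> measurable (enlarge \<Omega>) (count_space UNIV)"
proof -
  note [measurable] = markov_chain_measurable[OF mc]
  have *: "Measurable.pred (enlarge \<Omega>) (\<lambda>z. enat k \<le> hazard_time h X z)" for k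
    unfolding enat_le_hazard_time_iff survival_def enlarge_def by measurable
  have eq: "hazard_time h X z = t \<longleftrightarrow>
      (case t of enat k \<Rightarrow> enat k \<le> hazard_time h X z \<and> \<not> enat (Suc k) \<le> hazard_time h X z
       | \<infinity> \<Rightarrow> (\<forall>k. enat k \<le> hazard_time h X z))" for z t
    by (cases "hazard_time h X z"; cases t) (auto simp: not_le intro: exI[of _ "Suc _"])
  have "Measurable.pred (enlarge \<Omega>) (\<lambda>z. hazard_time h X z = t)" for t
    unfolding eq using * by (cases t) auto
  then have "{z \<in> space (enlarge \<Omega>). hazard_time h X z = t} \<in> sets (enlarge \<Omega>)" for t
    by measurable
  then show ?thesis
    by (simp add: measurable_count_space_eq2_countable vimage_def Int_def conj_commute)
qed

text \<open>A fixed path makes the survival probability a constant \<open>c\<close>, so the event is a rectangle in the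
  product space, with second side \<open>u < c\<close> when \<open>k > 0\<close>. The path may end as early as \<open>k - 1\<close>, since
  \<open>k \<le> T\<close> is decided by the states before time \<open>k\<close>.\<close>

lemma prob_hazard_time_path:
  assumes "k \<le> Suc n"
  shows "\<P>(z in enlarge \<Omega>. enat k \<le> hazard_time h X z \<and> (\<forall>i\<le>n. lift_process X i z = x i)) =
    survival h x k * \<P>(z in enlarge \<Omega>. \<forall>i\<le>n. lift_process X i z = x i)"
proof -
  have \<Omega>: "prob_space \<Omega>" using mc by (simp add: markov_chain_def)
  interpret U: prob_space "uniform_measure lborel {0..1::real}" by (rule prob_space_uniform)
  note [measurable] = markov_chain_measurable[OF mc]
  let ?A = "{\<omega> \<in> space \<Omega>. \<forall>i\<le>n. X i \<omega> = x i}" and ?B = "{u. k = 0 \<or> u < survival h x k}"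
  have surv: "survival h (\<lambda>j. X j \<omega>) k = survival h x k" if "\<omega> \<in> ?A" for \<omega>
    using that assms unfolding survival_def by (intro prod.cong) auto
  have "{z \<in> space (enlarge \<Omega>). enat k \<le> hazard_time h X z \<and> (\<forall>i\<le>n. lift_process X i z = x i)} = ?A \<times> ?B"
    using surv by (auto simp: space_enlarge enat_le_hazard_time_iff lift_process_def)
  then have "\<P>(z in enlarge \<Omega>. enat k \<le> hazard_time h X z \<and> (\<forall>i\<le>n. lift_process X i z = x i)) =
      measure \<Omega> ?A * measure (uniform_measure lborel {0..1}) ?B"
    by (simp add: measure_enlarge_Times[OF \<Omega>])
  also have "measure (uniform_measure lborel {0..1}) ?B = survival h x k"
    using survival_bounds[of x k] U.prob_space measure_uniform_lessThan[of "survival h x k"]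
    by (cases "k = 0") (simp_all add: survival_def)
  also have "measure \<Omega> ?A = \<P>(z in enlarge \<Omega>. \<forall>i\<le>n. lift_process X i z = x i)"
    using measure_enlarge_fst[OF \<Omega>, of "\<lambda>\<omega>. \<forall>i\<le>n. X i \<omega> = x i"] by (simp add: lift_process_def)
  finally show ?thesis by simp
qed

lemma randomized_stopping_time_hazard_time:
  "randomized_stopping_time (enlarge \<Omega>) (lift_process X) (hazard_time h X)"
proof -
  interpret prob_space "enlarge \<Omega>" using mc by (intro prob_space_enlarge) (simp add: markov_chain_def)
  note [measurable] = markov_chain_measurable[OF markov_chain_lift_process[OF mc]] measurable_hazard_time
  have cond: "\<P>(z in enlarge \<Omega>. hazard_time h X z = enat k \<bar> \<forall>i\<le>n. lift_process X i z = x i) =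
      survival h x k - survival h x (Suc k)"
    if "k \<le> n" "\<P>(z in enlarge \<Omega>. \<forall>i\<le>n. lift_process X i z = x i) > 0" for k n x
  proof -
    let ?E = "\<lambda>k. {z \<in> space (enlarge \<Omega>). enat k \<le> hazard_time h X z \<and> (\<forall>i\<le>n. lift_process X i z = x i)}"
    have "{z \<in> space (enlarge \<Omega>). hazard_time h X z = enat k \<and> (\<forall>i\<le>n. lift_process X i z = x i)} = ?E k - ?E (Suc k)"
      by (auto simp: Suc_ile_eq)
    moreover have "prob (?E k - ?E (Suc k)) = prob (?E k) - prob (?E (Suc k))"
      by (rule finite_measure_Diff) (auto simp: Suc_ile_eq)
    ultimately show ?thesis
      using that prob_hazard_time_path[of k n x] prob_hazard_time_path[of "Suc k" n x]
      by (simp add: cond_prob_def field_simps)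
  qed
  show ?thesis
    unfolding randomized_stopping_time_def
  proof (intro conjI allI impI)
    fix k n x assume "k \<le> n" and pos: "\<P>(z in enlarge \<Omega>. \<forall>i\<le>n. lift_process X i z = x i) > 0"
    have "\<P>(z in enlarge \<Omega>. \<forall>i\<le>n. lift_process X i z = x i) \<le> \<P>(z in enlarge \<Omega>. \<forall>i\<le>k. lift_process X i z = x i)"
      using \<open>k \<le> n\<close> by (intro finite_measure_mono) auto
    then show "\<P>(z in enlarge \<Omega>. hazard_time h X z = enat k \<bar> \<forall>i\<le>n. lift_process X i z = x i) =
        \<P>(z in enlarge \<Omega>. hazard_time h X z = enat k \<bar> \<forall>i\<le>k. lift_process X i z = x i)"
      using \<open>k \<le> n\<close> pos by (simp add: cond)
  qed (rule measurable_hazard_time)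
qed

text \<open>Surviving time \<open>k\<close> in the state \<open>e\<close> costs the factor \<open>1 - h k e\<close>, path by path.\<close>

lemma prob_hazard_time_Suc:
  assumes e: "e \<in> {1..M}"
  shows "\<P>(z in enlarge \<Omega>. enat (Suc k) \<le> hazard_time h X z \<and> lift_process X k z = e) =
    (1 - h k e) * \<P>(z in enlarge \<Omega>. enat k \<le> hazard_time h X z \<and> lift_process X k z = e)"
proof -
  interpret prob_space "enlarge \<Omega>" using mc by (intro prob_space_enlarge) (simp add: markov_chain_def)
  note mc' = markov_chain_lift_process[OF mc]
  note [measurable] = markov_chain_measurable[OF mc'] measurable_hazard_time
  have path: "\<P>(z in enlarge \<Omega>. (enat l \<le> hazard_time h X z \<and> lift_process X k z = e) \<and> (\<forall>i\<le>k. lift_process X i z = x i)) =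
      (if x k = e then survival h x l * \<P>(z in enlarge \<Omega>. \<forall>i\<le>k. lift_process X i z = x i) else 0)"
    if "l \<le> Suc k" for l x
  proof -
    have "{z \<in> space (enlarge \<Omega>). (enat l \<le> hazard_time h X z \<and> lift_process X k z = e) \<and> (\<forall>i\<le>k. lift_process X i z = x i)} =
      (if x k = e then {z \<in> space (enlarge \<Omega>). enat l \<le> hazard_time h X z \<and> (\<forall>i\<le>k. lift_process X i z = x i)} else {})"
      by auto
    then show ?thesis using prob_hazard_time_path[OF that, of x] by simp
  qed
  have "\<P>(z in enlarge \<Omega>. enat (Suc k) \<le> hazard_time h X z \<and> lift_process X k z = e) =
      (\<Sum>x\<in>{..k} \<rightarrow>\<^sub>E {1..M}. if x k = e then survival h x (Suc k) * \<P>(z in enlarge \<Omega>. \<forall>i\<le>k. lift_process X i z = x i) else 0)"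
    by (subst markov_chain_path_decomposition[OF mc', of _ k], measurable)
      (intro sum.cong refl path le_refl)
  also have "\<dots> = (1 - h k e) * (\<Sum>x\<in>{..k} \<rightarrow>\<^sub>E {1..M}. if x k = e then survival h x k * \<P>(z in enlarge \<Omega>. \<forall>i\<le>k. lift_process X i z = x i) else 0)"
    unfolding sum_distrib_left by (intro sum.cong) (auto simp: survival_def)
  also have "(\<Sum>x\<in>{..k} \<rightarrow>\<^sub>E {1..M}. if x k = e then survival h x k * \<P>(z in enlarge \<Omega>. \<forall>i\<le>k. lift_process X i z = x i) else 0) =
      \<P>(z in enlarge \<Omega>. enat k \<le> hazard_time h X z \<and> lift_process X k z = e)"
    by (subst (2) markov_chain_path_decomposition[OF mc', of _ k], measurable)
      (intro sum.cong refl path[symmetric] le_SucI le_refl)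
  finally show ?thesis .
qed

end
end

section \<open>Existence of a fastest strong stationary time\<close>

lemma sep_ge:
  assumes "e \<in> {1..M}"
  shows "1 - \<mu> e / \<pi> e \<le> sep M \<mu> \<pi>"
  unfolding sep_def using assms by (intro Max_ge) auto

text \<open>The separation one step earlier, with the value 1 before the chain starts; it turns out to be
  the probability of \<open>k \<le> T\<close>.\<close>

definition sep_before :: "nat \<Rightarrow> (nat \<Rightarrow> real) \<Rightarrow> (nat \<Rightarrow> nat \<Rightarrow> real) \<Rightarrow> (nat \<Rightarrow> real) \<Rightarrow> nat \<Rightarrow> real" where
  "sep_before M \<nu> P \<pi> k = (case k of 0 \<Rightarrow> 1 | Suc l \<Rightarrow> sep M (dist_at M \<nu> P l) \<pi>)"

text \<open>The numerator is the mass to be stopped in the state \<open>e\<close> at time \<open>k\<close>, namely \<open>\<pi> e\<close> times the drop of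
  the separation. The denominator is the mass still running in \<open>e\<close>. Where the denominator vanishes so
  does the numerator, and the convention \<open>x / 0 = 0\<close> gives a correct hazard; outside \<open>{1..M}\<close> the
  value 0 keeps all hazards in \<open>[0, 1]\<close>.\<close>

definition sst_hazard :: "nat \<Rightarrow> (nat \<Rightarrow> real) \<Rightarrow> (nat \<Rightarrow> nat \<Rightarrow> real) \<Rightarrow> (nat \<Rightarrow> real) \<Rightarrow> nat \<Rightarrow> nat \<Rightarrow> real" where
  "sst_hazard M \<nu> P \<pi> k e =
    (if e \<in> {1..M} then
       (sep_before M \<nu> P \<pi> k - sep_before M \<nu> P \<pi> (Suc k)) * \<pi> e /
       (dist_at M \<nu> P k e - (1 - sep_before M \<nu> P \<pi> k) * \<pi> e)
     else 0)"

context
  fixes M :: nat and \<nu> :: "nat \<Rightarrow> real" and P :: "nat \<Rightarrow> nat \<Rightarrow> real" and \<pi> :: "nat \<Rightarrow> real"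
  assumes M: "M \<ge> 1" and \<nu>: "prob_vector M \<nu>" and P: "stochastic_matrix M P"
    and st: "stationary M P \<pi>" and pos: "\<And>e. e \<in> {1..M} \<Longrightarrow> \<pi> e > 0"
begin

private abbreviation (input) "\<mu> \<equiv> dist_at M \<nu> P"
private abbreviation (input) "\<sigma> \<equiv> sep_before M \<nu> P \<pi>"
private abbreviation (input) "haz \<equiv> sst_hazard M \<nu> P \<pi>"

text \<open>The separation is the least \<open>s\<close> for which \<open>(1 - s) \<pi>\<close> lies below the law of the chain. This is why
  there is always enough running mass to stop.\<close>

lemma separation_minorizes:
  assumes "e \<in> {1..M}"
  shows "(1 - \<sigma> (Suc k)) * \<pi> e \<le> \<mu> k e"
  using sep_ge[OF assms, of "\<mu> k" \<pi>] pos[OF assms] by (simp add: sep_before_def field_simps)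

text \<open>As \<open>\<pi>\<close> is invariant, the running mass left after stopping at time \<open>k\<close> evolves by \<open>P\<close>.\<close>

lemma residual_Suc:
  assumes "e \<in> {1..M}"
  shows "\<mu> (Suc k) e - (1 - \<sigma> (Suc k)) * \<pi> e = (\<Sum>l=1..M. (\<mu> k l - (1 - \<sigma> (Suc k)) * \<pi> l) * P l e)"
proof -
  have "\<pi> e = (\<Sum>l=1..M. \<pi> l * P l e)" using st assms by (simp add: stationary_def)
  then have "(1 - \<sigma> (Suc k)) * \<pi> e = (1 - \<sigma> (Suc k)) * (\<Sum>l=1..M. \<pi> l * P l e)" by simp
  also have "\<dots> = (\<Sum>l=1..M. (1 - \<sigma> (Suc k)) * \<pi> l * P l e)"
    unfolding sum_distrib_left by (simp only: mult.assoc)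
  finally have "(1 - \<sigma> (Suc k)) * \<pi> e = (\<Sum>l=1..M. (1 - \<sigma> (Suc k)) * \<pi> l * P l e)" .
  then show ?thesis by (simp add: left_diff_distrib sum_subtractf)
qed

lemma residual_nonneg:
  assumes e: "e \<in> {1..M}"
  shows "0 \<le> \<mu> k e - (1 - \<sigma> k) * \<pi> e"
proof (cases k)
  case 0
  then show ?thesis using \<nu> e by (simp add: sep_before_def prob_vector_def)
next
  case (Suc l)
  have "0 \<le> (\<Sum>j=1..M. (\<mu> l j - (1 - \<sigma> (Suc l)) * \<pi> j) * P j e)"
  proof (rule sum_nonneg)
    fix j assume j: "j \<in> {1..M}"
    have "0 \<le> P j e" using P j e by (auto simp: stochastic_matrix_def prob_vector_def)
    then show "0 \<le> (\<mu> l j - (1 - \<sigma> (Suc l)) * \<pi> j) * P j e"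
      using separation_minorizes[OF j, of l] by simp
  qed
  then show ?thesis using residual_Suc[OF e, of l] Suc by simp
qed

text \<open>The hazards are nonnegative because the separation decreases: the law of the next step still lies
  above the same multiple of \<open>\<pi>\<close>.\<close>

lemma sep_before_antimono: "\<sigma> (Suc k) \<le> \<sigma> k"
proof -
  have "1 - \<mu> k e / \<pi> e \<le> \<sigma> k" if e: "e \<in> {1..M}" for e
    using residual_nonneg[OF e, of k] pos[OF e] by (simp add: field_simps)
  then show ?thesis
    using M unfolding sep_before_def[of _ _ _ _ "Suc k"] by (simp add: sep_def)
qed

lemma sst_hazard_bounds: "0 \<le> haz k e \<and> haz k e \<le> 1"
proof (cases "e \<in> {1..M}")
  case True
  have "0 \<le> (\<sigma> k - \<sigma> (Suc k)) * \<pi> e" using sep_before_antimono[of k] pos[OF True] by simp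
  moreover have "(\<sigma> k - \<sigma> (Suc k)) * \<pi> e \<le> \<mu> k e - (1 - \<sigma> k) * \<pi> e"
    using separation_minorizes[OF True, of k] by (simp add: algebra_simps)
  ultimately show ?thesis
    using True residual_nonneg[OF True, of k] unfolding sst_hazard_def
    by (auto simp: divide_le_eq_1 intro!: divide_nonneg_nonneg)
qed (auto simp: sst_hazard_def)

lemma sst_hazard_removes:
  assumes e: "e \<in> {1..M}"
  shows "(1 - haz k e) * (\<mu> k e - (1 - \<sigma> k) * \<pi> e) = \<mu> k e - (1 - \<sigma> (Suc k)) * \<pi> e"
proof -
  let ?d = "\<mu> k e - (1 - \<sigma> k) * \<pi> e" and ?t = "(\<sigma> k - \<sigma> (Suc k)) * \<pi> e"
  have "0 \<le> ?t" using sep_before_antimono[of k] pos[OF e] by simp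
  moreover have "?t \<le> ?d" using separation_minorizes[OF e, of k] by (simp add: algebra_simps)
  ultimately have "haz k e * ?d = ?t" using e by (cases "?d = 0") (auto simp: sst_hazard_def)
  then show ?thesis by (simp add: algebra_simps)
qed

lemma sum_separation_remainder: "(\<Sum>e=1..M. \<mu> k e - (1 - \<sigma> j) * \<pi> e) = \<sigma> j"
proof -
  have "(\<Sum>e=1..M. \<mu> k e) = 1"
  proof (induction k)
    case (Suc k)
    have "(\<Sum>e=1..M. \<mu> (Suc k) e) = (\<Sum>l=1..M. \<mu> k l * (\<Sum>e=1..M. P l e))"
      unfolding sum_distrib_left by simp (rule sum.swap)
    also have "\<dots> = (\<Sum>l=1..M. \<mu> k l)"
      using P by (intro sum.cong) (auto simp: stochastic_matrix_def prob_vector_def)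
    finally show ?case using Suc by simp
  qed (use \<nu> in \<open>simp add: prob_vector_def\<close>)
  moreover have "(\<Sum>e=1..M. \<pi> e) = 1" using st by (simp add: stationary_def prob_vector_def)
  moreover have "(\<Sum>e=1..M. (1 - \<sigma> j) * \<pi> e) = (1 - \<sigma> j) * (\<Sum>e=1..M. \<pi> e)"
    by (rule sum_distrib_left[symmetric])
  ultimately show ?thesis by (simp add: sum_subtractf)
qed

context
  fixes \<Omega> and X :: "nat \<Rightarrow> 'w \<Rightarrow> nat"
  assumes mc: "markov_chain M \<nu> P \<Omega> X"
begin

private abbreviation (input) "\<Omega>e \<equiv> enlarge \<Omega>"
private abbreviation (input) "Y \<equiv> lift_process X"
private abbreviation (input) "T \<equiv> hazard_time haz X"

text \<open>Running mass in each state, before and after the stopping decision at time \<open>k\<close>, by induction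
  alternating between that decision and a step of the chain.\<close>

lemma prob_fsst_ge_state:
  assumes e: "e \<in> {1..M}"
  shows "\<P>(z in \<Omega>e. enat k \<le> T z \<and> Y k z = e) = \<mu> k e - (1 - \<sigma> k) * \<pi> e"
    and "\<P>(z in \<Omega>e. enat (Suc k) \<le> T z \<and> Y k z = e) = \<mu> k e - (1 - \<sigma> (Suc k)) * \<pi> e"
proof -
  note mc' = markov_chain_lift_process[OF mc]
  note [measurable] = measurable_hazard_time[OF sst_hazard_bounds mc]
  have *: "\<P>(z in \<Omega>e. enat (Suc k) \<le> T z \<and> Y k z = e) = \<mu> k e - (1 - \<sigma> (Suc k)) * \<pi> e"
    if "\<P>(z in \<Omega>e. enat k \<le> T z \<and> Y k z = e) = \<mu> k e - (1 - \<sigma> k) * \<pi> e" "e \<in> {1..M}" for k e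
    using prob_hazard_time_Suc[OF sst_hazard_bounds mc that(2), of k] that(1) sst_hazard_removes[OF that(2), of k]
    by simp
  show 1: "\<P>(z in \<Omega>e. enat k \<le> T z \<and> Y k z = e) = \<mu> k e - (1 - \<sigma> k) * \<pi> e"
    using e
  proof (induction k arbitrary: e)
    case 0
    then show ?case using mc' by (simp add: sep_before_def markov_chain_def flip: zero_enat_def)
  next
    case (Suc k)
    have "\<P>(z in \<Omega>e. enat (Suc k) \<le> T z \<and> Y (Suc k) z = e) =
        (\<Sum>l=1..M. \<P>(z in \<Omega>e. enat (Suc k) \<le> T z \<and> Y k z = l) * P l e)"
      by (rule markov_step[OF mc' _ prob_hazard_time_path[OF sst_hazard_bounds mc] Suc.prems]) auto
    also have "\<dots> = (\<Sum>l=1..M. (\<mu> k l - (1 - \<sigma> (Suc k)) * \<pi> l) * P l e)"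
      by (intro sum.cong refl) (simp only: *[OF Suc.IH])
    also have "\<dots> = \<mu> (Suc k) e - (1 - \<sigma> (Suc k)) * \<pi> e" by (rule residual_Suc[OF Suc.prems, symmetric])
    finally show ?case .
  qed
  show "\<P>(z in \<Omega>e. enat (Suc k) \<le> T z \<and> Y k z = e) = \<mu> k e - (1 - \<sigma> (Suc k)) * \<pi> e"
    by (rule *[OF 1 e])
qed

lemma prob_fsst_ge: "\<P>(z in \<Omega>e. enat k \<le> T z) = \<sigma> k"
proof -
  note mc' = markov_chain_lift_process[OF mc]
  interpret prob_space \<Omega>e using mc' by (simp add: markov_chain_def)
  note [measurable] = measurable_hazard_time[OF sst_hazard_bounds mc] markov_chain_measurable[OF mc']
  have "\<P>(z in \<Omega>e. enat k \<le> T z) = (\<Sum>e=1..M. \<P>(z in \<Omega>e. enat k \<le> T z \<and> Y k z = e))"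
    using markov_chain_range[OF mc'] by (intro measure_partition) auto
  also have "\<dots> = (\<Sum>e=1..M. \<mu> k e - (1 - \<sigma> k) * \<pi> e)"
    by (intro sum.cong refl prob_fsst_ge_state(1))
  finally show ?thesis by (simp only: sum_separation_remainder)
qed

lemma prob_fsst_gt: "\<P>(z in \<Omega>e. T z > enat k) = sep M (\<mu> k) \<pi>"
  using prob_fsst_ge[of "Suc k"] by (simp add: Suc_ile_eq sep_before_def)

lemma strong_stationary_time_hazard: "strong_stationary_time M \<pi> \<Omega>e Y T"
proof (rule strong_stationary_timeI[OF markov_chain_lift_process[OF mc]
      randomized_stopping_time_hazard_time[OF sst_hazard_bounds mc]])
  note mc' = markov_chain_lift_process[OF mc]
  interpret prob_space \<Omega>e using mc' by (simp add: markov_chain_def)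
  note [measurable] = measurable_hazard_time[OF sst_hazard_bounds mc] markov_chain_measurable[OF mc']
  fix k e assume e: "e \<in> {1..M}"
  have diff: "\<P>(z in \<Omega>e. T z = enat k \<and> R z) =
      \<P>(z in \<Omega>e. enat k \<le> T z \<and> R z) - \<P>(z in \<Omega>e. enat (Suc k) \<le> T z \<and> R z)"
    if [measurable]: "Measurable.pred \<Omega>e R" for R
  proof -
    have "{z \<in> space \<Omega>e. T z = enat k \<and> R z} =
        {z \<in> space \<Omega>e. enat k \<le> T z \<and> R z} - {z \<in> space \<Omega>e. enat (Suc k) \<le> T z \<and> R z}"
      by (auto simp: Suc_ile_eq)
    moreover have "prob ({z \<in> space \<Omega>e. enat k \<le> T z \<and> R z} - {z \<in> space \<Omega>e. enat (Suc k) \<le> T z \<and> R z}) =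
        \<P>(z in \<Omega>e. enat k \<le> T z \<and> R z) - \<P>(z in \<Omega>e. enat (Suc k) \<le> T z \<and> R z)"
    proof (rule finite_measure_Diff)
      show "{z \<in> space \<Omega>e. enat k \<le> T z \<and> R z} \<in> events" "{z \<in> space \<Omega>e. enat (Suc k) \<le> T z \<and> R z} \<in> events"
        by measurable
    qed (auto simp: Suc_ile_eq)
    ultimately show ?thesis by presburger
  qed
  have "\<P>(z in \<Omega>e. T z = enat k \<and> Y k z = e) = (\<sigma> k - \<sigma> (Suc k)) * \<pi> e"
    by (subst diff) (simp_all add: prob_fsst_ge_state[OF e] algebra_simps)
  moreover have "\<P>(z in \<Omega>e. T z = enat k) = \<sigma> k - \<sigma> (Suc k)"
    using diff[of "\<lambda>_. True"] prob_fsst_ge[of k] prob_fsst_ge[of "Suc k"] by simp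
  ultimately show "\<P>(z in \<Omega>e. T z = enat k \<and> Y k z = e) = \<P>(z in \<Omega>e. T z = enat k) * \<pi> e"
    by simp
qed

end

theorem ex_fastest_strong_stationary_time:
  assumes mc: "markov_chain M \<nu> P \<Omega> X"
  shows "\<exists>T. fastest_strong_stationary_time TYPE('v) M \<nu> P \<pi> (enlarge \<Omega>) (lift_process X) T \<and>
    (\<forall>k. \<P>(\<omega> in enlarge \<Omega>. T \<omega> > enat k) = sep M (dist_at M \<nu> P k) \<pi>)"
proof (intro exI[of _ "hazard_time haz X"] conjI allI)
  show "\<P>(\<omega> in enlarge \<Omega>. hazard_time haz X \<omega> > enat k) = sep M (\<mu> k) \<pi>" for k
    by (rule prob_fsst_gt[OF mc])
  then show "fastest_strong_stationary_time TYPE('v) M \<nu> P \<pi> (enlarge \<Omega>) (lift_process X) (hazard_time haz X)"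
    unfolding fastest_strong_stationary_time_def
    using markov_chain_lift_process[OF mc] strong_stationary_time_hazard[OF mc]
      sep_le_strong_stationary_time_tail[OF _ _ st pos M]
    by metis
qed

end

section \<open>The law of the fastest strong stationary time\<close>

text \<open>The tails determine the atoms at finite values, hence all events that omit \<open>\<infinity>\<close>; an event that
  contains \<open>\<infinity>\<close> is the complement of such an event.\<close>

lemma (in prob_space) prob_enat_eq_pmf:
  fixes T :: "'a \<Rightarrow> enat"
  assumes [measurable]: "T \<in> measurable M (count_space UNIV)"
    and tail: "\<And>k. \<P>(\<omega> in M. T \<omega> > enat k) = 1 - measure_pmf.prob D {..enat k}"
  shows "\<P>(\<omega> in M. T \<omega> \<in> B) = measure_pmf.prob D B"
proof -
  have cdf: "\<P>(\<omega> in M. T \<omega> \<le> enat k) = measure_pmf.prob D {..enat k}" for k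
    using tail[of k] prob_neg[of "\<lambda>\<omega>. T \<omega> > enat k"] by (simp add: not_less)
  have atom: "\<P>(\<omega> in M. T \<omega> = enat k) = measure_pmf.prob D {enat k}" for k
  proof (cases k)
    case 0
    have "{..enat 0} = {enat 0}" by (auto simp: zero_enat_def[symmetric])
    then show ?thesis using cdf[of 0] 0 by (simp add: zero_enat_def[symmetric])
  next
    case (Suc l)
    have le: "t \<le> enat (Suc l) \<longleftrightarrow> t = enat (Suc l) \<or> t \<le> enat l" for t by (cases t) auto
    have "measure_pmf.prob D ({enat (Suc l)} \<union> {..enat l}) = measure_pmf.prob D {enat (Suc l)} + measure_pmf.prob D {..enat l}"
      by (rule measure_pmf.finite_measure_Union) auto
    moreover have "{enat (Suc l)} \<union> {..enat l} = {..enat (Suc l)}" by (auto simp: le)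
    moreover have "prob ({\<omega> \<in> space M. T \<omega> = enat (Suc l)} \<union> {\<omega> \<in> space M. T \<omega> \<le> enat l}) =
        \<P>(\<omega> in M. T \<omega> = enat (Suc l)) + \<P>(\<omega> in M. T \<omega> \<le> enat l)"
      by (rule finite_measure_Union) auto
    moreover have "{\<omega> \<in> space M. T \<omega> = enat (Suc l)} \<union> {\<omega> \<in> space M. T \<omega> \<le> enat l} = {\<omega> \<in> space M. T \<omega> \<le> enat (Suc l)}"
      by (auto simp: le)
    ultimately show ?thesis using cdf[of l] cdf[of "Suc l"] Suc by simp
  qed
  have finite_values: "\<P>(\<omega> in M. T \<omega> \<in> S) = measure_pmf.prob D S" if S: "\<infinity> \<notin> S" for S
  proof -
    have "(\<lambda>k. \<P>(\<omega> in M. T \<omega> = enat k \<and> enat k \<in> S)) sums prob (\<Union>k. {\<omega> \<in> space M. T \<omega> = enat k \<and> enat k \<in> S})"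
      by (rule finite_measure_UNION) (auto simp: disjoint_family_on_def)
    moreover have "(\<Union>k. {\<omega> \<in> space M. T \<omega> = enat k \<and> enat k \<in> S}) = {\<omega> \<in> space M. T \<omega> \<in> S}"
      using S by (auto, metis not_infinity_eq)
    moreover have "(\<lambda>k. measure_pmf.prob D ({enat k} \<inter> S)) sums measure_pmf.prob D (\<Union>k. {enat k} \<inter> S)"
      by (rule measure_pmf.finite_measure_UNION) (auto simp: disjoint_family_on_def)
    moreover have "(\<Union>k. {enat k} \<inter> S) = S"
      using S by (auto, metis not_infinity_eq)
    moreover have "\<P>(\<omega> in M. T \<omega> = enat k \<and> enat k \<in> S) = measure_pmf.prob D ({enat k} \<inter> S)" for k
      using atom[of k] by (cases "enat k \<in> S") auto
    ultimately show ?thesis by (simp add: sums_unique2)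
  qed
  show ?thesis
  proof (cases "\<infinity> \<in> B")
    case True
    then have "\<P>(\<omega> in M. T \<omega> \<notin> B) = measure_pmf.prob D (- B)"
      using finite_values[of "- B"] by simp
    moreover have "\<P>(\<omega> in M. T \<omega> \<notin> B) = 1 - \<P>(\<omega> in M. T \<omega> \<in> B)"
      by (rule prob_neg) auto
    moreover have "measure_pmf.prob D (- B) = 1 - measure_pmf.prob D B"
      using measure_pmf.prob_compl[of B D] by (simp add: Compl_eq_Diff_UNIV)
    ultimately show ?thesis by simp
  qed (rule finite_values)
qed

lemma ex_pmf_mixture:
  assumes a: "prob_vector M a"
  shows "\<exists>D. \<forall>B. measure_pmf.prob D B = (\<Sum>i=1..M. a i * measure_pmf.prob (G i) B)"
proof -
  define A where "A = embed_pmf (\<lambda>i. if i \<in> {1..M} then a i else 0)"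
  have "(\<integral>\<^sup>+i. ennreal (if i \<in> {1..M} then a i else 0) \<partial>count_space UNIV) =
      (\<integral>\<^sup>+i. ennreal (a i) * indicator {1..M} i \<partial>count_space UNIV)"
    by (intro nn_integral_cong) auto
  also have "\<dots> = (\<Sum>i=1..M. ennreal (a i))"
    by (simp add: nn_integral_count_space_indicator[symmetric] nn_integral_count_space_finite)
  also have "\<dots> = 1" using a by (subst sum_ennreal) (auto simp: prob_vector_def)
  finally have A: "pmf A i = (if i \<in> {1..M} then a i else 0)" for i
    unfolding A_def using a by (subst pmf_embed_pmf) (auto simp: prob_vector_def)
  have "measure_pmf.prob (bind_pmf A G) B = (\<Sum>i=1..M. a i * measure_pmf.prob (G i) B)" for B
  proof -
    have "ennreal (measure_pmf.prob (bind_pmf A G) B) = (\<integral>\<^sup>+i. ennreal (measure_pmf.prob (G i) B) \<partial>A)"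
      by (simp flip: measure_pmf.emeasure_eq_measure)
    also have "\<dots> = (\<Sum>i=1..M. ennreal (measure_pmf.prob (G i) B) * ennreal (pmf A i))"
      by (rule nn_integral_measure_pmf_support) (auto simp: A set_pmf_iff)
    also have "\<dots> = (\<Sum>i=1..M. ennreal (a i * measure_pmf.prob (G i) B))"
      using a by (intro sum.cong) (auto simp: A prob_vector_def ennreal_mult mult.commute)
    also have "\<dots> = ennreal (\<Sum>i=1..M. a i * measure_pmf.prob (G i) B)"
      using a by (intro sum_ennreal) (auto simp: prob_vector_def)
    finally show ?thesis
      using a by (subst (asm) ennreal_inj) (auto intro!: sum_nonneg simp: prob_vector_def)
  qed
  then show ?thesis by blast
qed

theorem theorem4p16:
  fixes M :: nat and p a \<pi> \<nu> :: "nat \<Rightarrow> real" and P :: "nat \<Rightarrow> nat \<Rightarrow> real"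
  defines "P \<equiv> trans_matrix M \<pi> p" and "\<nu> \<equiv> init_dist M \<pi> a"
  assumes "M \<ge> 2"
    and "\<forall>k\<in>{1..M-1}. 0 \<le> p k \<and> p k \<le> 1"
    and "prob_vector M a"
    and "prob_vector M \<pi>"
    and "\<forall>k\<in>{1..M}. \<pi> k > 0"
    and "\<forall>k\<in>{1..M}. \<forall>s\<in>{1..M}. P k s \<ge> 0"
  shows "stochastic_matrix M P \<and> prob_vector M \<nu> \<and>
    (\<forall>(\<Omega> :: 'w measure) X. markov_chain M \<nu> P \<Omega> X \<longrightarrow>
       (\<exists>T. fastest_strong_stationary_time TYPE('v) M \<nu> P \<pi> (enlarge \<Omega>) (lift_process X) T \<and>
            (\<forall>k. \<P>(\<omega> in enlarge \<Omega>. T \<omega> > enat k) = sep M (dist_at M \<nu> P k) \<pi>) \<and>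
            (\<forall>B. \<P>(\<omega> in enlarge \<Omega>. T \<omega> \<in> B) =
               (\<Sum>i=1..M-1. a i * measure_pmf.prob (geo_sum_pmf p {i..M-1}) B)
                 + a M * indicator B 0))) \<and>
    stationary M P \<pi> \<and>
    spectrum (map_mat complex_of_real (to_mat M P)) =
      (\<lambda>k. complex_of_real (1 - p k)) ` {1..M-1} \<union> {1} \<and>
    char_poly (to_mat M P) = (\<Prod>k=1..M-1. [:-(1 - p k), 1:]) * [:-1, 1:]"
proof -
  have M: "M \<ge> 2" by fact
  then have M1: "M \<ge> 1" by simp
  have pos: "\<And>k. k \<in> {1..M} \<Longrightarrow> \<pi> k > 0" and pi: "prob_vector M \<pi>" and a: "prob_vector M a"
    and p: "\<And>k. k \<in> {1..M-1} \<Longrightarrow> 0 \<le> p k \<and> p k \<le> 1" using assms by auto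
  have st: "stationary M P \<pi>" unfolding P_def by (rule stationary_trans_matrix[OF M pi pos])
  have stoch: "stochastic_matrix M P"
    using assms(8) sum_trans_matrix_row[OF M pi pos, of _ p]
    by (auto simp: stochastic_matrix_def prob_vector_def P_def)
  have nu: "prob_vector M \<nu>" unfolding \<nu>_def by (rule prob_vector_init_dist[OF M pi pos a])
  obtain D where D: "\<And>B. measure_pmf.prob D B = (\<Sum>i=1..M. a i * measure_pmf.prob (geo_sum_pmf p {i..M-1}) B)"
    using ex_pmf_mixture[OF a, of "\<lambda>i. geo_sum_pmf p {i..M-1}"] by blast
  have sep: "sep M (dist_at M \<nu> P k) \<pi> = 1 - measure_pmf.prob D {..enat k}" for k
    unfolding D P_def \<nu>_def
    using sep_eq_dual[where M = M and p = p and a = a and \<pi> = \<pi> and n = k, OF M pi pos a p]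
      dist_at_dual_top[where M = M and p = p and a = a and n = 0 and k = k, OF p M1] by simp
  have mixture: "measure_pmf.prob D B = (\<Sum>i=1..M-1. a i * measure_pmf.prob (geo_sum_pmf p {i..M-1}) B) + a M * indicator B 0" for B
  proof -
    have "{1..M} = insert M {1..M-1}" "M \<notin> {1..M-1}" "{M..M-1} = {}" using M by auto
    then show ?thesis unfolding D by (simp add: indicator_def)
  qed
  have "\<exists>T. fastest_strong_stationary_time TYPE('v) M \<nu> P \<pi> (enlarge \<Omega>) (lift_process X) T \<and>
            (\<forall>k. \<P>(\<omega> in enlarge \<Omega>. T \<omega> > enat k) = sep M (dist_at M \<nu> P k) \<pi>) \<and>
            (\<forall>B. \<P>(\<omega> in enlarge \<Omega>. T \<omega> \<in> B) =
               (\<Sum>i=1..M-1. a i * measure_pmf.prob (geo_sum_pmf p {i..M-1}) B) + a M * indicator B 0)"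
    if mc: "markov_chain M \<nu> P \<Omega> X" for \<Omega> :: "'w measure" and X
  proof -
    interpret prob_space "enlarge \<Omega>" using mc by (intro prob_space_enlarge) (simp add: markov_chain_def)
    obtain T where T: "fastest_strong_stationary_time TYPE('v) M \<nu> P \<pi> (enlarge \<Omega>) (lift_process X) T"
      and tail: "\<And>k. \<P>(\<omega> in enlarge \<Omega>. T \<omega> > enat k) = sep M (dist_at M \<nu> P k) \<pi>"
      using ex_fastest_strong_stationary_time[OF M1 nu stoch st pos mc] by blast
    have "T \<in> measurable (enlarge \<Omega>) (count_space UNIV)"
      using T by (simp add: fastest_strong_stationary_time_def strong_stationary_time_def randomized_stopping_time_def)
    then have "\<P>(\<omega> in enlarge \<Omega>. T \<omega> \<in> B) = measure_pmf.prob D B" for B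
      by (rule prob_enat_eq_pmf) (simp add: tail sep)
    then show ?thesis using T tail mixture by auto
  qed
  then show ?thesis
    using stoch nu st spectrum_trans_matrix[OF M pi pos, of p] char_poly_trans_matrix[OF M pi pos, of p]
    by (simp add: P_def)
qed

end
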